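(* Let $m\to\infty$, and let $n=n_m\to\infty$, $s=s_m$ and $P=P_m$ depend on $m$. For each $m$ let $X_{1},\dots,X_{n}$ be the sizes of the attribute sets defining the active random intersection graph $G_s(n,m,P)$, let $Z_{mi}=\binom{m}{s}^{-1/2}n^{1/2}\binom{X_i}{s}$ for $1\le i\le n$, and let $d_m(v_1)$ be the degree of the vertex $v_1$ in $G_s(n,m,P)$. Assume that there is a random variable $Z$ such that: (i) $Z_{m1}$ converges in distribution to $Z$ as $m\to\infty$; (ii) $\mathbf E Z<\infty$ and $\lim_{m\to\infty}\mathbf E Z_{m1}=\mathbf E Z$. Denote $\mu=\mathbf E Z$. (A) If $s_m=O(1)$ as $m\to\infty$, then for every $k=0,1,2,\dots$ $$\lim_{m\to\infty}\mathbf P\bigl(d_m(v_1)=k\bigr)=\frac1{k!}\,\mathbf E\bigl((Z\mu)^k e^{-Z\mu}\bigr).\qquad( * )$$ (B) The conclusion $( * )$ also holds for every $k=0,1,2,\dots$ if the condition $s_m=O(1)$ is replaced by the following: there exists $0<a<1$ such that $s\le am$, and $(s!/n)^{1/s}=o(m)$ as $m\to\infty$, provided that, in addition to (i) and (ii), (iii) $\displaystyle \frac{(s!)^{1/s}}{n^{(s+1)/s}}\sum_{k=2}^n\bigl(Z_{m1}Z_{mk}\bigr)^{(s+1)/s}\to 0$ in probability as $m\to\infty$.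
   Context: Active random intersection graph $G_s(n,m,P)$: let $W=\{w_1,\dots,w_m\}$, let $P$ be a probability distribution on $\{0,1,\dots,m\}$, and let $1\le s\le m$ be an integer. Let $D_1,\dots,D_n$ be independent identically distributed random subsets of $W$ with $\mathbf P(D_i=A)=P(|A|)\binom{m}{|A|}^{-1}$ for each $A\subset W$. The vertex set is $V=\{v_1,\dots,v_n\}$, and distinct vertices $v_i,v_j$ are adjacent iff $|D_i\cap D_j|\ge s$. Write $X_i=|D_i|$, so that $X_1,\dots,X_n$ are i.i.d. with distribution $P$. As usual $\binom{x}{s}=0$ for integers $0\le x<s$. *)

theory Defs
  imports "HOL-Probability.Probability" "HOL-Library.Landau_Symbols"
begin

text \<open>
  The attribute set \<open>W\<close> is \<open>{1..m}\<close> and the vertex set \<open>V\<close> is \<open>{1..n}\<close>, vertex \<open>i\<close> standing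
  for \<open>v\<^sub>i\<close>; the family \<open>D\<close> is only constrained at indices in \<open>{1..n}\<close>. The support
  condition on \<open>P\<close> makes it a distribution on \<open>{0,...,m}\<close>.
\<close>

locale active_random_intersection_graph = prob_space M
  for M :: "'a measure" +
  fixes n m s :: nat
    and P :: "nat pmf"
    and D :: "nat \<Rightarrow> 'a \<Rightarrow> nat set"
  assumes s_bounds: "1 \<le> s" "s \<le> m"
    and size_distribution: "set_pmf P \<subseteq> {0..m}"
    and attribute_sets_indep: "indep_vars (\<lambda>_. count_space (Pow {1..m})) D {1..n}"
    and attribute_set_law:
      "\<And>i A. i \<in> {1..n} \<Longrightarrow> A \<subseteq> {1..m} \<Longrightarrow>
         prob {\<omega> \<in> space M. D i \<omega> = A} = pmf P (card A) / real (m choose card A)"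

text \<open>
  The next two notions concern one realization \<open>A\<close> of the attribute sets, with \<open>A i\<close> the
  set attached to vertex \<open>i\<close>.
\<close>

definition rig_adjacent :: "nat \<Rightarrow> nat \<Rightarrow> (nat \<Rightarrow> nat set) \<Rightarrow> nat \<Rightarrow> nat \<Rightarrow> bool" where
  "rig_adjacent n s A i j \<longleftrightarrow>
     i \<in> {1..n} \<and> j \<in> {1..n} \<and> i \<noteq> j \<and> s \<le> card (A i \<inter> A j)"

definition rig_degree :: "nat \<Rightarrow> nat \<Rightarrow> (nat \<Rightarrow> nat set) \<Rightarrow> nat \<Rightarrow> nat" where
  "rig_degree n s A i = card {j. rig_adjacent n s A i j}"

definition scaled_size :: "nat \<Rightarrow> nat \<Rightarrow> nat \<Rightarrow> nat set \<Rightarrow> real" where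
  "scaled_size n m s A =
     real (m choose s) powr (- 1 / 2) * real n powr (1 / 2) * real (card A choose s)"

text \<open>Convergence to zero in probability; the \<open>X m\<close> may live on different probability spaces.\<close>

definition tendsto_zero_in_probability ::
  "(nat \<Rightarrow> 'a measure) \<Rightarrow> (nat \<Rightarrow> 'a \<Rightarrow> real) \<Rightarrow> bool" where
  "tendsto_zero_in_probability M X \<longleftrightarrow>
     (\<forall>\<epsilon>>0. (\<lambda>m. measure (M m) {\<omega> \<in> space (M m). \<bar>X m \<omega>\<bar> > \<epsilon>}) \<longlonglongrightarrow> 0)"

end

theory Submission
  imports Defs
begin

text \<open>
  Given \<open>D 1 = A\<close>, the degree of vertex 1 is binomial with parameters \<open>n - 1\<close> and the edge
  probability \<open>p(A)\<close>. Counting common \<open>s\<close>-subsets (the first two Bonferroni bounds) shows that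
  \<open>n p(A)\<close> is at most \<open>z(A) E z\<close>, where \<open>z\<close> is the scaled size, and that the deficit is at most
  the mean over \<open>B\<close> of \<open>z(A) z(B) min(1, r)\<close> with \<open>r \<le> m / (m - s) (z(A) z(B) s! / n)\<^sup>1\<^sup>/\<^sup>s\<close>.
  Since \<open>z\<close> is uniformly integrable, it suffices to let the expected deficit tend to zero after
  restricting to \<open>z(A), z(B) \<le> K\<close>. There \<open>r\<close> tends to zero uniformly if \<open>s\<close> is bounded, and
  otherwise hypothesis (iii) with bounded convergence applies. Hence the degree is asymptotically
  Poisson with random mean \<open>\<mu> z(A)\<close>, which converges weakly to \<open>\<mu> Z\<close>.
\<close>

section \<open>Poisson approximation of binomial weights\<close>

text \<open>Only a first moment of \<open>z\<close> is available, and this shapes the estimates. The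
  usual Poisson error \<open>2 n p^2\<close> is quadratic in \<open>p\<close>, hence in
  \<open>z(A)\<close>; its geometric mean with the trivial bound 1 is of order
  \<open>sqrt n p\<close>, which is linear in \<open>z(A)\<close> and of order
  \<open>n^(-1/2)\<close> after averaging. Likewise the second Bonferroni bound alone would leave
  \<open>z(A) z(B) r\<close>, for which the estimate of \<open>r\<close> gives a moment of order
  \<open>1 + 1/s\<close>; this is why the trivial bound \<open>z(A) z(B)\<close> has to cap it. The
  ratio is \<open>r = (|A| - s) (|B| - s) / (m - s)\<close>. For \<open>B\<close> uniform of a given
  size, it is the mean of \<open>(s + 1) C(h, s + 1)\<close> divided by the mean of
  \<open>C(h, s)\<close>, where \<open>h\<close> is the size of the intersection of \<open>A\<close>
  and \<open>B\<close>. Its estimate is an s-th root, taken after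
  \<open>(k - s)^s <= s! C(k, s)\<close> for \<open>k = |A|, |B|\<close> and
  \<open>s! C(m, s) <= m^s\<close>. With \<open>u = z(A) z(B)\<close>, the exponents in hypothesis
  (iii) are exactly those of \<open>u r / n\<close> after this estimate.\<close>

definition poisson_weight :: "nat \<Rightarrow> real \<Rightarrow> real" where
  "poisson_weight k x = x ^ k / fact k * exp (- x)"

definition binomial_weight :: "nat \<Rightarrow> real \<Rightarrow> nat \<Rightarrow> real" where
  "binomial_weight n p k = real (n choose k) * p ^ k * (1 - p) ^ (n - k)"

lemma poisson_weight_nonneg: "0 \<le> x \<Longrightarrow> 0 \<le> poisson_weight k x"
  by (simp add: poisson_weight_def)

lemma poisson_weight_le_1:
  assumes "0 \<le> x" shows "poisson_weight k x \<le> 1"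
\<comment> \<open>The Poisson law requires a positive rate; at rate 0 the weight is 1 for
  \<open>k = 0\<close> and 0 otherwise.\<close>
proof (cases "x = 0")
  case True
  then show ?thesis by (simp add: poisson_weight_def power_0_left)
next
  case False
  then have "poisson_weight k x = pmf (poisson_pmf x) k"
    using assms by (simp add: poisson_weight_def)
  then show ?thesis by (simp add: pmf_le_1)
qed

lemma poisson_weight_abs: "0 \<le> x \<Longrightarrow> \<bar>poisson_weight k x\<bar> \<le> 1"
  using poisson_weight_nonneg poisson_weight_le_1 by fastforce

lemma poisson_weight_deriv_0:
  "(poisson_weight 0 has_real_derivative - poisson_weight 0 x) (at x)"
  unfolding poisson_weight_def[abs_def] by (auto intro!: derivative_eq_intros)

lemma poisson_weight_deriv_Suc:
  "(poisson_weight (Suc k) has_real_derivative poisson_weight k x - poisson_weight (Suc k) x) (at x)"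
proof -
  have "((\<lambda>x. x ^ Suc k / fact (Suc k)) has_real_derivative real (Suc k) * x ^ k / fact (Suc k)) (at x)"
    by (auto intro!: derivative_eq_intros simp del: fact_Suc power_Suc)
  also have "real (Suc k) * x ^ k / fact (Suc k) = x ^ k / fact k"
    by (simp add: divide_simps)
  finally have "((\<lambda>x. x ^ Suc k / fact (Suc k)) has_real_derivative x ^ k / fact k) (at x)" .
  moreover have "((\<lambda>x::real. exp (- x)) has_real_derivative - exp (- x)) (at x)"
    by (auto intro!: derivative_eq_intros)
  ultimately show ?thesis
    unfolding poisson_weight_def[abs_def]
    by (rule DERIV_cong[OF DERIV_mult]) (simp del: fact_Suc power_Suc)
qed

text \<open>For \<open>k > 0\<close> the derivative is a difference of two weights, both in the unit
  interval; for \<open>k = 0\<close> it is minus a weight. This gives Lipschitz constant 1 for every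
  \<open>k\<close>.\<close>

lemma poisson_weight_deriv:
  "\<exists>D. (poisson_weight k has_real_derivative D) (at x) \<and> (0 \<le> x \<longrightarrow> \<bar>D\<bar> \<le> 1)"
proof (cases k)
  case 0
  then show ?thesis
    using poisson_weight_deriv_0[of x] poisson_weight_abs[of x 0] by fastforce
next
  case (Suc j)
  have "\<bar>poisson_weight j x - poisson_weight (Suc j) x\<bar> \<le> 1" if "0 \<le> x"
    using poisson_weight_nonneg[OF that] poisson_weight_le_1[OF that] by (smt (verit))
  then show ?thesis using poisson_weight_deriv_Suc[of j x] Suc by blast
qed

lemma mvt_bound:
  fixes f :: "real \<Rightarrow> real"
  assumes "a \<le> b" "\<And>x. a \<le> x \<Longrightarrow> x \<le> b \<Longrightarrow> \<exists>D. (f has_real_derivative D) (at x) \<and> \<bar>D\<bar> \<le> C"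
  shows "\<bar>f b - f a\<bar> \<le> C * (b - a)"
proof (cases "a = b")
  case False
  then have "a < b" using assms by simp
  obtain D where D: "\<And>x. a \<le> x \<Longrightarrow> x \<le> b \<Longrightarrow> (f has_real_derivative D x) (at x)"
      "\<And>x. a \<le> x \<Longrightarrow> x \<le> b \<Longrightarrow> \<bar>D x\<bar> \<le> C"
    using assms(2) by metis
  obtain z where "a < z" "z < b" "f b - f a = (b - a) * D z"
    using MVT2[OF \<open>a < b\<close>, of f D] D by auto
  then show ?thesis using D(2)[of z] \<open>a < b\<close> by (simp add: abs_mult mult.commute mult_right_mono)
qed simp

lemma poisson_weight_lipschitz:
  assumes "0 \<le> x" "0 \<le> y"
  shows "\<bar>poisson_weight k x - poisson_weight k y\<bar> \<le> \<bar>x - y\<bar>"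
proof -
  have *: "\<bar>poisson_weight k b - poisson_weight k a\<bar> \<le> 1 * (b - a)" if "0 \<le> a" "a \<le> b" for a b
    by (rule mvt_bound) (use that poisson_weight_deriv in \<open>auto, meson dual_order.trans\<close>)
  show ?thesis
  proof (cases "x \<le> y")
    case True
    then show ?thesis using *[of x y] assms by (simp add: abs_minus_commute)
  next
    case False
    then show ?thesis using *[of y x] assms by simp
  qed
qed

text \<open>As a function of \<open>p\<close> the difference vanishes at 0, and its derivative is
  itself an increment of weights, hence of order \<open>p\<close> by the Lipschitz bound; one more
  mean value step gives \<open>p\<close> squared. The constant 2 is the one needed for positive
  \<open>k\<close>, where two increments occur.\<close>

lemma poisson_weight_bernoulli_step_0:
  assumes "0 \<le> x" "0 \<le> p"
  shows "\<bar>poisson_weight 0 (x + p) - (1 - p) * poisson_weight 0 x\<bar> \<le> 2 * p\<^sup>2"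
proof -
  let ?g = "\<lambda>t. poisson_weight 0 (x + t) - (1 - t) * poisson_weight 0 x"
  have "\<bar>?g p - ?g 0\<bar> \<le> 2 * p * (p - 0)"
  proof (rule mvt_bound)
    fix t assume t: "0 \<le> t" "t \<le> p"
    have "(?g has_real_derivative (poisson_weight 0 x - poisson_weight 0 (x + t))) (at t)"
      by (auto intro!: derivative_eq_intros DERIV_chain2[OF poisson_weight_deriv_0])
    moreover have "\<bar>poisson_weight 0 x - poisson_weight 0 (x + t)\<bar> \<le> 2 * p"
      using poisson_weight_lipschitz[of x "x + t" 0] assms t by auto
    ultimately show "\<exists>D. (?g has_real_derivative D) (at t) \<and> \<bar>D\<bar> \<le> 2 * p" by blast
  qed (use assms in auto)
  then show ?thesis by (simp add: power2_eq_square)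
qed

lemma poisson_weight_bernoulli_step_Suc:
  assumes "0 \<le> x" "0 \<le> p"
  shows "\<bar>poisson_weight (Suc k) (x + p) - ((1 - p) * poisson_weight (Suc k) x
    + p * poisson_weight k x)\<bar> \<le> 2 * p\<^sup>2"
proof -
  let ?g = "\<lambda>t. poisson_weight (Suc k) (x + t) - ((1 - t) * poisson_weight (Suc k) x
    + t * poisson_weight k x)"
  have "\<bar>?g p - ?g 0\<bar> \<le> 2 * p * (p - 0)"
  proof (rule mvt_bound)
    fix t assume t: "0 \<le> t" "t \<le> p"
    let ?D = "(poisson_weight k (x + t) - poisson_weight k x)
      - (poisson_weight (Suc k) (x + t) - poisson_weight (Suc k) x)"
    have "(?g has_real_derivative ?D) (at t)"
      by (auto intro!: derivative_eq_intros DERIV_chain2[OF poisson_weight_deriv_Suc])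
    moreover have "\<bar>?D\<bar> \<le> 2 * p"
      using poisson_weight_lipschitz[of "x + t" x k] poisson_weight_lipschitz[of "x + t" x "Suc k"]
        assms t by auto
    ultimately show "\<exists>D. (?g has_real_derivative D) (at t) \<and> \<bar>D\<bar> \<le> 2 * p" by blast
  qed (use assms in auto)
  then show ?thesis by (simp add: power2_eq_square)
qed

lemma binomial_weight_Suc_0: "binomial_weight (Suc n) p 0 = (1 - p) * binomial_weight n p 0"
  by (simp add: binomial_weight_def)

lemma binomial_weight_Suc_Suc:
  "binomial_weight (Suc n) p (Suc k)
    = (1 - p) * binomial_weight n p (Suc k) + p * binomial_weight n p k"
proof (cases "Suc k \<le> n")
  case True
  then have "n - k = Suc (n - Suc k)" by simp
  then show ?thesis by (simp add: binomial_weight_def algebra_simps)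
next
  case False
  then show ?thesis by (simp add: binomial_weight_def binomial_eq_0)
qed

lemma binomial_weight_bounds:
  assumes "0 \<le> p" "p \<le> 1"
  shows "0 \<le> binomial_weight n p k" "binomial_weight n p k \<le> 1"
proof -
  have "binomial_weight n p k = pmf (binomial_pmf n p) k"
    using assms by (simp add: binomial_weight_def)
  then show "0 \<le> binomial_weight n p k" "binomial_weight n p k \<le> 1"
    by (simp_all add: pmf_le_1)
qed

text \<open>
  Convolving with a Bernoulli law is a contraction in the supremum norm, so the one-step errors
  just add up.
\<close>

lemma binomial_poisson_approx:
  assumes "0 \<le> p" "p \<le> 1"
  shows "\<bar>binomial_weight n p k - poisson_weight k (real n * p)\<bar> \<le> 2 * real n * p\<^sup>2"
proof (induction n arbitrary: k)
  case 0
  show ?case by (cases k) (auto simp: binomial_weight_def poisson_weight_def)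
next
  case (Suc n)
  let ?x = "real n * p"
  have x: "0 \<le> ?x" "real (Suc n) * p = ?x + p" using assms by (auto simp: algebra_simps)
  let ?e = "\<lambda>k. binomial_weight n p k - poisson_weight k ?x"
  show ?case
  proof (cases k)
    case 0
    have "\<bar>(1 - p) * ?e 0\<bar> \<le> 1 * \<bar>?e 0\<bar>"
      unfolding abs_mult by (rule mult_right_mono) (use assms in auto)
    moreover have "binomial_weight (Suc n) p 0 - poisson_weight 0 (real (Suc n) * p) =
        (1 - p) * ?e 0 - (poisson_weight 0 (?x + p) - (1 - p) * poisson_weight 0 ?x)"
      unfolding x(2) binomial_weight_Suc_0 by (simp add: algebra_simps)
    ultimately show ?thesis
      using Suc[of 0] poisson_weight_bernoulli_step_0[OF x(1) assms(1)] 0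
      by (simp add: algebra_simps)
  next
    case (Suc j)
    have "\<bar>(1 - p) * ?e (Suc j) + p * ?e j\<bar> \<le> (1 - p) * \<bar>?e (Suc j)\<bar> + p * \<bar>?e j\<bar>"
      using abs_triangle_ineq[of "(1 - p) * ?e (Suc j)" "p * ?e j"] assms by (simp add: abs_mult)
    also have "\<dots> \<le> (1 - p) * (2 * real n * p\<^sup>2) + p * (2 * real n * p\<^sup>2)"
      using Suc.IH assms by (intro add_mono mult_left_mono) auto
    finally have "\<bar>(1 - p) * ?e (Suc j) + p * ?e j\<bar> \<le> 2 * real n * p\<^sup>2"
      by (simp add: algebra_simps)
    moreover have "binomial_weight (Suc n) p (Suc j) - poisson_weight (Suc j) (real (Suc n) * p) =
        ((1 - p) * ?e (Suc j) + p * ?e j) - (poisson_weight (Suc j) (?x + p)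
          - ((1 - p) * poisson_weight (Suc j) ?x + p * poisson_weight j ?x))"
      unfolding x(2) binomial_weight_Suc_Suc by (simp add: algebra_simps)
    ultimately show ?thesis
      using poisson_weight_bernoulli_step_Suc[OF x(1) assms(1), of j] Suc
      by (simp add: algebra_simps)
  qed
qed

text \<open>An error in the unit interval satisfies \<open>e^2 <= e\<close>, so the quadratic bound
  may be replaced by its square root. The result is linear in \<open>p\<close>, which lets it be
  averaged using only the mean of \<open>z\<close>.\<close>

lemma binomial_poisson_approx_sqrt:
  assumes "0 \<le> p" "p \<le> 1"
  shows "\<bar>binomial_weight n p k - poisson_weight k (real n * p)\<bar> \<le> sqrt (2 * real n) * p"
proof -
  let ?e = "\<bar>binomial_weight n p k - poisson_weight k (real n * p)\<bar>"
  have "0 \<le> real n * p" using assms by simp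
  then have "?e \<le> 1"
    using binomial_weight_bounds[OF assms, of n k] poisson_weight_nonneg poisson_weight_le_1
    by (smt (verit))
  then have "?e\<^sup>2 \<le> ?e" unfolding power2_eq_square by (intro mult_left_le) auto
  also have "\<dots> \<le> 2 * real n * p\<^sup>2" by (rule binomial_poisson_approx[OF assms])
  also have "\<dots> = (sqrt (2 * real n) * p)\<^sup>2" by (simp add: power_mult_distrib)
  finally show ?thesis by (rule power2_le_imp_le) (use assms in auto)
qed

section \<open>Counting subsets of intersections\<close>

lemma sum_Pow_card:
  fixes g :: "nat \<Rightarrow> real"
  assumes "finite U"
  shows "(\<Sum>C\<in>Pow U. g (card C)) = (\<Sum>j\<le>card U. real (card U choose j) * g j)"
proof -
  have "(\<Sum>C\<in>Pow U. g (card C)) = (\<Sum>j\<le>card U. \<Sum>C\<in>{C \<in> Pow U. card C = j}. g (card C))"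
    by (rule sum.group[symmetric]) (use assms in \<open>auto intro: card_mono\<close>)
  also have "\<dots> = (\<Sum>j\<le>card U. real (card {C \<in> Pow U. card C = j}) * g j)"
    by simp
  also have "\<dots> = (\<Sum>j\<le>card U. real (card U choose j) * g j)"
    using n_subsets[OF assms] by (simp add: Pow_def)
  finally show ?thesis .
qed

lemma sum_supersets_card:
  fixes g :: "nat \<Rightarrow> real"
  assumes "finite U" "S \<subseteq> U"
  shows "(\<Sum>B | B \<subseteq> U \<and> S \<subseteq> B. g (card B))
    = (\<Sum>j\<le>card U - card S. real (card U - card S choose j) * g (j + card S))"
proof -
  have fin: "finite S" "finite (U - S)" using assms finite_subset by auto
  have "(\<Sum>B | B \<subseteq> U \<and> S \<subseteq> B. g (card B)) = (\<Sum>C\<in>Pow (U - S). g (card C + card S))"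
  proof (rule sum.reindex_bij_witness[where i = "\<lambda>C. C \<union> S" and j = "\<lambda>B. B - S"])
    fix B assume "B \<in> {B. B \<subseteq> U \<and> S \<subseteq> B}"
    then have "finite B" "S \<subseteq> B" using assms finite_subset by auto
    then show "g (card (B - S) + card S) = g (card B)"
      by (simp add: card_Diff_subset fin card_mono)
  qed (use assms in auto)
  also have "\<dots> = (\<Sum>j\<le>card (U - S). real (card (U - S) choose j) * g (j + card S))"
    by (rule sum_Pow_card) (use fin in auto)
  finally show ?thesis by (simp add: card_Diff_subset fin assms)
qed

text \<open>Double counting of pairs \<open>(S, B)\<close> with \<open>S\<close> a
  \<open>t\<close>-subset of \<open>A\<close> contained in \<open>B\<close>. As \<open>g\<close>
  sees only the size of \<open>B\<close>, the sum over the supersets of \<open>S\<close> is the same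
  for every \<open>S\<close>, so \<open>A\<close> enters only through the number of its
  \<open>t\<close>-subsets.\<close>

lemma sum_Pow_choose_Int:
  fixes g :: "nat \<Rightarrow> real"
  assumes "finite U" "A \<subseteq> U"
  shows "(\<Sum>B\<in>Pow U. g (card B) * real (card (A \<inter> B) choose t))
    = real (card A choose t) *
      (\<Sum>j\<le>card U - t. real (card U - t choose j) * g (j + t))"
proof -
  have finA: "finite A" using assms finite_subset by auto
  let ?T = "{S. S \<subseteq> A \<and> card S = t}"
  have "(\<Sum>B\<in>Pow U. g (card B) * real (card (A \<inter> B) choose t))
      = (\<Sum>B\<in>Pow U. \<Sum>S\<in>{S \<in> ?T. S \<subseteq> B}. g (card B))"
  proof (rule sum.cong[OF refl])
    fix B assume "B \<in> Pow U"
    then have "card (A \<inter> B) choose t = card {S. S \<subseteq> A \<inter> B \<and> card S = t}"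
      using finA by (subst n_subsets) auto
    also have "{S. S \<subseteq> A \<inter> B \<and> card S = t} = {S \<in> ?T. S \<subseteq> B}" by auto
    finally show "g (card B) * real (card (A \<inter> B) choose t)
        = (\<Sum>S\<in>{S \<in> ?T. S \<subseteq> B}. g (card B))"
      by simp
  qed
  also have "\<dots> = (\<Sum>S\<in>?T. \<Sum>B\<in>{B \<in> Pow U. S \<subseteq> B}. g (card B))"
    by (rule sum.swap_restrict) (use assms finA in auto)
  also have "\<dots> = (\<Sum>S\<in>?T. \<Sum>j\<le>card U - t. real (card U - t choose j) * g (j + t))"
  proof (rule sum.cong[OF refl])
    fix S assume "S \<in> ?T"
    then show "(\<Sum>B\<in>{B \<in> Pow U. S \<subseteq> B}. g (card B))
        = (\<Sum>j\<le>card U - t. real (card U - t choose j) * g (j + t))"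
      using sum_supersets_card[OF assms(1), of S g] assms by auto
  qed
  also have "\<dots> = real (card A choose t) *
      (\<Sum>j\<le>card U - t. real (card U - t choose j) * g (j + t))"
    using n_subsets[OF finA, of t] by simp
  finally show ?thesis .
qed

text \<open>The case \<open>A = U\<close> of the preceding identity determines its right-hand factor.\<close>

lemma sum_Pow_choose_Int_symmetric:
  fixes g :: "nat \<Rightarrow> real"
  assumes "finite U" "A \<subseteq> U"
  shows "real (card U choose t) * (\<Sum>B\<in>Pow U. g (card B) * real (card (A \<inter> B) choose t))
    = real (card A choose t) * (\<Sum>B\<in>Pow U. g (card B) * real (card B choose t))"
proof -
  have "(\<Sum>B\<in>Pow U. g (card B) * real (card B choose t))
      = (\<Sum>B\<in>Pow U. g (card B) * real (card (U \<inter> B) choose t))"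
    by (rule sum.cong) (auto simp: Int_absorb1)
  then show ?thesis
    using sum_Pow_choose_Int[OF assms, of g t] sum_Pow_choose_Int[OF assms(1) subset_refl, of g t]
    by simp
qed

lemma Suc_times_binomial_Suc: "Suc k * (n choose Suc k) = (n - k) * (n choose k)"
proof (cases "k \<le> n")
  case True
  then show ?thesis
    using binomial_absorb_comp[of n k] binomial_absorption[of k n] 
    by (metis binomial_absorb_comp binomial_absorption)
qed (simp add: binomial_eq_0)

lemma of_bool_le_choose: "of_bool (s \<le> h) \<le> real (h choose s)"
  by (cases "s \<le> h") (auto simp: Suc_le_eq binomial_eq_0)

text \<open>The left side equals \<open>(1 - (h - s)) * (h choose s)\<close> for
  \<open>s <= h\<close>: it is 1 at \<open>h = s\<close> and at most 0 beyond. The sharp Bonferroni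
  coefficient would be \<open>s\<close>; the weaker \<open>Suc s\<close> is chosen because it
  produces the factor \<open>h - s\<close>, from which the excess ratio arises without extra
  constants.\<close>

lemma of_bool_ge_choose:
  "real (h choose s) - real (Suc s) * real (h choose Suc s) \<le> of_bool (s \<le> h)"
proof -
  have eq: "real (Suc s) * real (h choose Suc s) = real (h - s) * real (h choose s)"
    using Suc_times_binomial_Suc[of s h] by (metis of_nat_mult)
  consider "h < s" | "h = s" | "s < h" by linarith
  then show ?thesis
  proof cases
    case 3
    then have "1 * real (h choose s) \<le> real (h - s) * real (h choose s)"
      by (intro mult_right_mono) auto
    moreover have "(0::real) \<le> of_bool (s \<le> h)" by simp
    ultimately show ?thesis unfolding eq by linarith
  qed (auto simp: binomial_eq_0)
qed

text \<open>The right side is a falling factorial, a product of \<open>k\<close> factors each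
  exceeding \<open>n - k\<close> when \<open>k <= n\<close>. It turns a bound on a binomial
  coefficient into one on a size.\<close>

lemma power_diff_le_fact_choose: "(n - k) ^ k \<le> fact k * (n choose k)"
proof (induction k)
  case (Suc k)
  have "(n - Suc k) ^ Suc k \<le> (n - k) * (n - k) ^ k"
    by (simp add: mult_mono power_mono)
  also have "\<dots> \<le> (n - k) * (fact k * (n choose k))"
    using Suc by simp
  also have "\<dots> = fact k * ((n - k) * (n choose k))"
    by (simp only: mult_ac)
  also have "\<dots> = fact k * (Suc k * (n choose Suc k))"
    by (simp only: Suc_times_binomial_Suc)
  also have "\<dots> = fact (Suc k) * (n choose Suc k)"
    by (simp only: fact_Suc mult_ac of_nat_id)
  finally show ?case .
qed simp

section \<open>The degree given the attribute set of the vertex\<close>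

definition (in active_random_intersection_graph) set_weight :: "nat set \<Rightarrow> real" where
  "set_weight A = pmf P (card A) / real (m choose card A)"

text \<open>The expectation of \<open>f\<close> under the common law of the attribute sets, written
  as a finite sum, so that no integrability question arises. It depends on \<open>m\<close> and
  \<open>P\<close> only; the probability space and the family \<open>D\<close> have
  disappeared.\<close>

definition (in active_random_intersection_graph) set_average :: "(nat set \<Rightarrow> real) \<Rightarrow> real" where
  "set_average f = (\<Sum>A\<in>Pow {1..m}. set_weight A * f A)"

definition (in active_random_intersection_graph) edge_prob :: "nat set \<Rightarrow> real" where
  "edge_prob A = set_average (\<lambda>B. of_bool (s \<le> card (A \<inter> B)))"

context active_random_intersection_graph begin

lemma D_measurable: "i \<in> {1..n} \<Longrightarrow> D i \<in> measurable M (count_space (Pow {1..m}))"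
  using attribute_sets_indep by (auto simp: indep_vars_def)

lemma D_subset: "i \<in> {1..n} \<Longrightarrow> \<omega> \<in> space M \<Longrightarrow> D i \<omega> \<subseteq> {1..m}"
  using measurable_space[OF D_measurable] by auto

lemma measurable_D_comp [measurable (raw)]:
  "i \<in> {1..n} \<Longrightarrow> (\<lambda>\<omega>. f (D i \<omega>)) \<in> measurable M (count_space UNIV)"
  using measurable_compose[OF D_measurable, of i f "count_space UNIV"] by simp

lemma set_weight_nonneg: "0 \<le> set_weight A"
  by (simp add: set_weight_def)

lemma prob_D_eq: "i \<in> {1..n} \<Longrightarrow> A \<subseteq> {1..m} \<Longrightarrow> prob {\<omega> \<in> space M. D i \<omega> = A} = set_weight A"
  by (simp add: attribute_set_law set_weight_def)

lemma set_average_1: "set_average (\<lambda>_. 1) = 1"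
proof -
  have "set_average (\<lambda>_. 1) = (\<Sum>A\<in>Pow {1..m}. pmf P (card A) / real (m choose card A))"
    by (simp add: set_average_def set_weight_def)
  also have "\<dots> = (\<Sum>j\<le>m. real (m choose j) * (pmf P j / real (m choose j)))"
    using sum_Pow_card[of "{1..m}" "\<lambda>j. pmf P j / real (m choose j)"] by simp
  also have "\<dots> = (\<Sum>j\<in>{0..m}. pmf P j)"
    by (rule sum.cong) auto
  also have "\<dots> = 1"
    using size_distribution by (intro sum_pmf_eq_1) auto
  finally show ?thesis .
qed

lemma set_average_cong:
  "(\<And>A. A \<subseteq> {1..m} \<Longrightarrow> f A = g A) \<Longrightarrow> set_average f = set_average g"
  by (auto simp: set_average_def intro!: sum.cong)

lemma set_average_mono:
  "(\<And>A. A \<subseteq> {1..m} \<Longrightarrow> f A \<le> g A) \<Longrightarrow> set_average f \<le> set_average g"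
  by (auto simp: set_average_def set_weight_nonneg intro!: sum_mono mult_left_mono)

lemma set_average_add: "set_average (\<lambda>A. f A + g A) = set_average f + set_average g"
  by (simp add: set_average_def sum.distrib algebra_simps)

lemma set_average_diff: "set_average (\<lambda>A. f A - g A) = set_average f - set_average g"
  by (simp add: set_average_def sum_subtractf algebra_simps)

lemma set_average_cmult: "set_average (\<lambda>A. c * f A) = c * set_average f"
  unfolding set_average_def sum_distrib_left by (simp only: mult_ac)

lemma set_average_multc: "set_average (\<lambda>A. f A * c) = set_average f * c"
  unfolding set_average_def sum_distrib_right by (simp only: mult_ac)

lemma set_average_nonneg: "(\<And>A. A \<subseteq> {1..m} \<Longrightarrow> 0 \<le> f A) \<Longrightarrow> 0 \<le> set_average f"
  by (auto simp: set_average_def set_weight_nonneg intro!: sum_nonneg)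

lemma set_average_const: "set_average (\<lambda>_. c) = c"
  using set_average_cmult[of c "\<lambda>_. 1"] set_average_1 by simp

lemma set_average_abs: "\<bar>set_average f\<bar> \<le> set_average (\<lambda>A. \<bar>f A\<bar>)"
  unfolding set_average_def
  by (rule order_trans[OF sum_abs]) (simp add: abs_mult set_weight_nonneg)

lemma edge_prob_nonneg: "0 \<le> edge_prob A"
  unfolding edge_prob_def by (rule set_average_nonneg) simp

lemma edge_prob_le_1: "edge_prob A \<le> 1"
  unfolding edge_prob_def
  using set_average_mono[of "\<lambda>B. of_bool (s \<le> card (A \<inter> B))" "\<lambda>_. 1"] set_average_1 by simp

section \<open>Laws of one, of two and of several attribute sets\<close>

lemma prob_D_in:
  assumes "i \<in> {1..n}"
  shows "prob {\<omega> \<in> space M. Q (D i \<omega>)} = set_average (\<lambda>A. of_bool (Q A))"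
proof -
  have "{\<omega> \<in> space M. Q (D i \<omega>)} = (\<Union>A\<in>{A \<in> Pow {1..m}. Q A}. {\<omega> \<in> space M. D i \<omega> = A})"
    using D_subset[OF assms] by auto
  also have "prob \<dots> = (\<Sum>A\<in>{A \<in> Pow {1..m}. Q A}. prob {\<omega> \<in> space M. D i \<omega> = A})"
    by (intro finite_measure_finite_Union)
      (use assms measurable_D_comp[OF assms] in \<open>auto simp: disjoint_family_on_def\<close>)
  also have "\<dots> = (\<Sum>A\<in>{A \<in> Pow {1..m}. Q A}. set_weight A)"
    by (rule sum.cong) (auto simp: prob_D_eq[OF assms])
  also have "\<dots> = set_average (\<lambda>A. of_bool (Q A))"
    unfolding set_average_def by (rule sum.mono_neutral_cong_left) auto
  finally show ?thesis .
qed

lemma prob_D_INT: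
  assumes "J \<noteq> {}" "J \<subseteq> {1..n}"
  shows "prob {\<omega> \<in> space M. \<forall>j\<in>J. Q j (D j \<omega>)}
    = (\<Prod>j\<in>J. set_average (\<lambda>A. of_bool (Q j A)))"
proof -
  have fin: "finite J" using assms finite_subset by auto
  have *: "D j -` {A \<in> Pow {1..m}. Q j A} \<inter> space M = {\<omega> \<in> space M. Q j (D j \<omega>)}" if "j \<in> J" for j
    using D_subset[of j] that assms(2) by fastforce
  have "{\<omega> \<in> space M. \<forall>j\<in>J. Q j (D j \<omega>)}
      = (\<Inter>j\<in>J. D j -` {A \<in> Pow {1..m}. Q j A} \<inter> space M)"
    using assms(1) * by auto
  also have "prob \<dots> = (\<Prod>j\<in>J. prob (D j -` {A \<in> Pow {1..m}. Q j A} \<inter> space M))"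
    by (rule indep_varsD[OF attribute_sets_indep]) (use assms fin in auto)
  also have "\<dots> = (\<Prod>j\<in>J. set_average (\<lambda>A. of_bool (Q j A)))"
    by (intro prod.cong refl) (use assms prob_D_in * in auto)
  finally show ?thesis .
qed

lemma prob_D_pair:
  assumes "i \<in> {1..n}" "j \<in> {1..n}" "i \<noteq> j" "A \<subseteq> {1..m}" "B \<subseteq> {1..m}"
  shows "prob {\<omega> \<in> space M. D i \<omega> = A \<and> D j \<omega> = B} = set_weight A * set_weight B"
proof -
  have single: "set_average (\<lambda>A'. of_bool (A' = A)) = set_weight A" if "A \<subseteq> {1..m}" for A
    using prob_D_in[OF assms(1), of "\<lambda>A'. A' = A"] prob_D_eq[OF assms(1) that] by simp
  have "{\<omega> \<in> space M. D i \<omega> = A \<and> D j \<omega> = B}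
      = {\<omega> \<in> space M. \<forall>l\<in>{i, j}. D l \<omega> = (if l = i then A else B)}"
    using assms(3) by auto
  then show ?thesis
    using prob_D_INT[of "{i, j}" "\<lambda>l X. X = (if l = i then A else B)"] assms single by simp
qed

text \<open>An attribute set takes finitely many values, so \<open>f (D i)\<close> is a finite
  combination of indicators of the events \<open>D i = A\<close>.\<close>

lemma expectation_D:
  assumes "i \<in> {1..n}"
  shows "expectation (\<lambda>\<omega>. f (D i \<omega>)) = set_average f"
    and "integrable M (\<lambda>\<omega>. f (D i \<omega>) :: real)"
proof -
  have meas: "{\<omega> \<in> space M. D i \<omega> = A} \<in> sets M" for A
    using measurable_D_comp[OF assms, of "\<lambda>B. B = A"] by simp
  have int: "integrable M (\<lambda>\<omega>. f A * indicator {\<omega> \<in> space M. D i \<omega> = A} \<omega>)" for A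
    using meas by (intro integrable_mult_right integrable_real_indicator) (auto simp: emeasure_eq_measure)
  have eq: "f (D i \<omega>) = (\<Sum>A\<in>Pow {1..m}. f A * indicator {\<omega> \<in> space M. D i \<omega> = A} \<omega>)"
    if "\<omega> \<in> space M" for \<omega>
    using that D_subset[OF assms that] by (simp add: indicator_def if_distrib sum.delta' cong: if_cong)
  have "integrable M (\<lambda>\<omega>. \<Sum>A\<in>Pow {1..m}. f A * indicator {\<omega> \<in> space M. D i \<omega> = A} \<omega>)"
    by (intro Bochner_Integration.integrable_sum int)
  then show "integrable M (\<lambda>\<omega>. f (D i \<omega>))"
    by (rule iffD2[OF Bochner_Integration.integrable_cong[OF refl eq], rotated])
  have "expectation (\<lambda>\<omega>. f (D i \<omega>))
      = expectation (\<lambda>\<omega>. \<Sum>A\<in>Pow {1..m}. f A * indicator {\<omega> \<in> space M. D i \<omega> = A} \<omega>)"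
    by (rule Bochner_Integration.integral_cong[OF refl eq])
  also have "\<dots> = (\<Sum>A\<in>Pow {1..m}. expectation (\<lambda>\<omega>. f A * indicator {\<omega> \<in> space M. D i \<omega> = A} \<omega>))"
    by (rule Bochner_Integration.integral_sum[OF int])
  also have "\<dots> = (\<Sum>A\<in>Pow {1..m}. f A * prob {\<omega> \<in> space M. D i \<omega> = A})"
    using meas by (intro sum.cong refl) (subst integral_mult_right_zero, subst Bochner_Integration.integral_indicator, auto simp: Int_absorb2)
  also have "\<dots> = set_average f"
    unfolding set_average_def by (rule sum.cong) (auto simp: prob_D_eq[OF assms])
  finally show "expectation (\<lambda>\<omega>. f (D i \<omega>)) = set_average f" .
qed

lemma expectation_D_pair:
  assumes "i \<in> {1..n}" "j \<in> {1..n}" "i \<noteq> j"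
  shows "expectation (\<lambda>\<omega>. f (D i \<omega>) (D j \<omega>)) = set_average (\<lambda>A. set_average (f A))"
    and "integrable M (\<lambda>\<omega>. f (D i \<omega>) (D j \<omega>) :: real)"
proof -
  let ?E = "\<lambda>C. {\<omega> \<in> space M. D i \<omega> = fst C \<and> D j \<omega> = snd C}"
  let ?I = "Pow {1..m} \<times> Pow {1..m}"
  have meas: "?E C \<in> sets M" for C
    using measurable_D_comp[OF assms(1), of "\<lambda>B. B = fst C"]
      measurable_D_comp[OF assms(2), of "\<lambda>B. B = snd C"] by simp
  have int: "integrable M (\<lambda>\<omega>. f (fst C) (snd C) * indicator (?E C) \<omega>)" for C
    using meas by (intro integrable_mult_right integrable_real_indicator) (auto simp: emeasure_eq_measure)
  have eq: "f (D i \<omega>) (D j \<omega>) = (\<Sum>C\<in>?I. f (fst C) (snd C) * indicator (?E C) \<omega>)"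
    if "\<omega> \<in> space M" for \<omega>
  proof -
    have "(\<Sum>C\<in>?I. f (fst C) (snd C) * indicator (?E C) \<omega>)
        = (\<Sum>C\<in>?I. if C = (D i \<omega>, D j \<omega>) then f (D i \<omega>) (D j \<omega>) else 0)"
      using that by (intro sum.cong) (auto simp: indicator_def)
    also have "\<dots> = f (D i \<omega>) (D j \<omega>)"
      using D_subset[OF assms(1) that] D_subset[OF assms(2) that]
      by (subst sum.delta) auto
    finally show ?thesis by simp
  qed
  have "integrable M (\<lambda>\<omega>. \<Sum>C\<in>?I. f (fst C) (snd C) * indicator (?E C) \<omega>)"
    by (intro Bochner_Integration.integrable_sum int)
  then show "integrable M (\<lambda>\<omega>. f (D i \<omega>) (D j \<omega>))"
    by (rule iffD2[OF Bochner_Integration.integrable_cong[OF refl eq], rotated])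
  have "expectation (\<lambda>\<omega>. f (D i \<omega>) (D j \<omega>))
      = expectation (\<lambda>\<omega>. \<Sum>C\<in>?I. f (fst C) (snd C) * indicator (?E C) \<omega>)"
    by (rule Bochner_Integration.integral_cong[OF refl eq])
  also have "\<dots> = (\<Sum>C\<in>?I. expectation (\<lambda>\<omega>. f (fst C) (snd C) * indicator (?E C) \<omega>))"
    by (rule Bochner_Integration.integral_sum[OF int])
  also have "\<dots> = (\<Sum>C\<in>?I. f (fst C) (snd C) * prob (?E C))"
    using meas by (intro sum.cong refl) (subst integral_mult_right_zero, subst Bochner_Integration.integral_indicator, auto simp: Int_absorb2)
  also have "\<dots> = (\<Sum>C\<in>?I. set_weight (fst C) * (set_weight (snd C) * f (fst C) (snd C)))"
    by (rule sum.cong) (auto simp: prob_D_pair[OF assms])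
  also have "\<dots> = set_average (\<lambda>A. set_average (f A))"
    unfolding set_average_def by (simp add: sum.cartesian_product' sum_distrib_left case_prod_beta)
  finally show "expectation (\<lambda>\<omega>. f (D i \<omega>) (D j \<omega>)) = set_average (\<lambda>A. set_average (f A))" .
qed

text \<open>Once \<open>A\<close> is fixed, adjacency of \<open>j\<close> to vertex 1 is a condition
  on \<open>D j\<close> alone. The event is therefore an intersection of \<open>n\<close> one-vertex
  events, index 1 carrying \<open>D 1 = A\<close>, and independence makes its probability a
  product.\<close>

lemma prob_neighbourhood:
  assumes "1 \<le> n" "A \<subseteq> {1..m}" "J \<subseteq> {2..n}"
  shows "prob {\<omega> \<in> space M. D 1 \<omega> = A \<and> {j \<in> {2..n}. s \<le> card (A \<inter> D j \<omega>)} = J}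
    = set_weight A * (edge_prob A ^ card J * (1 - edge_prob A) ^ (n - 1 - card J))"
proof -
  let ?Q = "\<lambda>j B. if j = 1 then B = A else (j \<in> J \<longleftrightarrow> s \<le> card (A \<inter> B))"
  let ?f = "\<lambda>j. set_average (\<lambda>B. of_bool (?Q j B))"
  have eq: "{\<omega> \<in> space M. D 1 \<omega> = A \<and> {j \<in> {2..n}. s \<le> card (A \<inter> D j \<omega>)} = J}
      = {\<omega> \<in> space M. \<forall>j\<in>{1..n}. ?Q j (D j \<omega>)}"
    using assms by (auto 0 3 simp: set_eq_iff)
  have f1: "?f 1 = set_weight A"
    using prob_D_in[of 1 "\<lambda>B. B = A"] prob_D_eq[of 1 A] assms by simp
  have fJ: "?f j = edge_prob A" if "j \<in> J" for j
  proof -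
    have "j \<noteq> 1" using that assms by auto
    then show ?thesis using that by (simp add: edge_prob_def)
  qed
  have fN: "?f j = 1 - edge_prob A" if "j \<in> {2..n} - J" for j
  proof -
    have "?f j = set_average (\<lambda>B. 1 - of_bool (s \<le> card (A \<inter> B)))"
      using that by (intro set_average_cong) auto
    then show ?thesis by (simp only: set_average_diff set_average_1 edge_prob_def)
  qed
  have split: "{1..n} = insert 1 (J \<union> ({2..n} - J))" "finite J" "1 \<notin> J \<union> ({2..n} - J)"
    using assms finite_subset[OF assms(3)] by auto
  have "prob {\<omega> \<in> space M. \<forall>j\<in>{1..n}. ?Q j (D j \<omega>)} = (\<Prod>j\<in>{1..n}. ?f j)"
    by (rule prob_D_INT) (use assms in auto)
  also have "\<dots> = ?f 1 * (\<Prod>j\<in>J \<union> ({2..n} - J). ?f j)"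
    unfolding split(1) by (rule prod.insert) (use split in auto)
  also have "(\<Prod>j\<in>J \<union> ({2..n} - J). ?f j) = (\<Prod>j\<in>J. ?f j) * (\<Prod>j\<in>{2..n} - J. ?f j)"
    by (rule prod.union_disjoint) (use split in auto)
  also have "(\<Prod>j\<in>J. ?f j) = (\<Prod>j\<in>J. edge_prob A)"
    by (rule prod.cong[OF refl fJ])
  also have "(\<Prod>j\<in>{2..n} - J. ?f j) = (\<Prod>j\<in>{2..n} - J. 1 - edge_prob A)"
    by (rule prod.cong[OF refl fN])
  also have "?f 1 * ((\<Prod>j\<in>J. edge_prob A) * (\<Prod>j\<in>{2..n} - J. 1 - edge_prob A))
      = set_weight A * (edge_prob A ^ card J * (1 - edge_prob A) ^ (n - 1 - card J))"
    using card_Diff_subset[OF split(2) assms(3)] by (simp only: f1 prod_constant card_atLeastAtMost)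
      (simp add: numeral_2_eq_2)
  finally show ?thesis by (simp only: eq)
qed

lemma prob_degree:
  assumes "1 \<le> n"
  shows "prob {\<omega> \<in> space M. rig_degree n s (\<lambda>i. D i \<omega>) 1 = k}
    = set_average (\<lambda>A. binomial_weight (n - 1) (edge_prob A) k)"
proof -
  \<comment> \<open>The set \<open>A\<close> is kept separate from \<open>D 1\<close>: the
    neighbourhood of a fixed \<open>A\<close> involves only the vertices from 2 on. The events
    \<open>E (A, J)\<close> then partition the degree event.\<close>
  define N where "N A \<omega> = {j \<in> {2..n}. s \<le> card (A \<inter> D j \<omega>)}" for A \<omega>
  let ?I = "Pow {1..m} \<times> {J. J \<subseteq> {2..n} \<and> card J = k}"
  define E where "E C = {\<omega> \<in> space M. D 1 \<omega> = fst C \<and> N (fst C) \<omega> = snd C}" for C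
  have deg: "rig_degree n s (\<lambda>i. D i \<omega>) 1 = card (N (D 1 \<omega>) \<omega>)" for \<omega>
    unfolding rig_degree_def rig_adjacent_def N_def using assms
    by (intro arg_cong[where f = card]) auto
  have N_sub: "N A \<omega> \<subseteq> {2..n}" for A \<omega> unfolding N_def by blast
  have D1: "D 1 \<omega> \<subseteq> {1..m}" if "\<omega> \<in> space M" for \<omega>
    using D_subset[of 1 \<omega>] assms that by simp
  have meas: "E C \<in> sets M" for C
  proof -
    have "E C = {\<omega> \<in> space M. D 1 \<omega> = fst C} \<inter>
        {\<omega> \<in> space M. (\<forall>j\<in>{2..n}. j \<in> snd C \<longleftrightarrow> s \<le> card (fst C \<inter> D j \<omega>)) \<and> snd C \<subseteq> {2..n}}"
      unfolding E_def N_def by blast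
    also have "\<dots> \<in> sets M"
    proof (intro sets.Int sets.sets_Collect_conj sets.sets_Collect_finite_All)
      show "{\<omega> \<in> space M. D 1 \<omega> = fst C} \<in> sets M"
        using measurable_D_comp[of 1 "\<lambda>B. B = fst C"] assms by simp
      show "{\<omega> \<in> space M. j \<in> snd C \<longleftrightarrow> s \<le> card (fst C \<inter> D j \<omega>)} \<in> sets M" if "j \<in> {2..n}" for j
        using measurable_D_comp[of j "\<lambda>B. j \<in> snd C \<longleftrightarrow> s \<le> card (fst C \<inter> B)"] that by simp
    qed (simp_all only: finite_atLeastAtMost sets.sets_Collect_const)
    finally show ?thesis .
  qed
  have prob_E: "prob (E C) = set_weight (fst C) *
      (edge_prob (fst C) ^ k * (1 - edge_prob (fst C)) ^ (n - 1 - k))" if "C \<in> ?I" for C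
    using that prob_neighbourhood[OF assms, of "fst C" "snd C"]
    unfolding E_def N_def by (simp only: mem_Times_iff Pow_iff mem_Collect_eq)
  have "{\<omega> \<in> space M. rig_degree n s (\<lambda>i. D i \<omega>) 1 = k} = (\<Union>C\<in>?I. E C)"
    unfolding deg E_def using N_sub D1 by (auto simp del: atLeastAtMost_iff)
  also have "prob \<dots> = (\<Sum>C\<in>?I. prob (E C))"
  proof (rule finite_measure_finite_Union)
    show "disjoint_family_on E ?I"
      unfolding disjoint_family_on_def E_def by (auto simp only: prod_eq_iff)
  qed (use meas in auto)
  also have "\<dots> = (\<Sum>C\<in>?I. set_weight (fst C) *
      (edge_prob (fst C) ^ k * (1 - edge_prob (fst C)) ^ (n - 1 - k)))"
    by (rule sum.cong[OF refl prob_E])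
  also have "\<dots> = (\<Sum>A\<in>Pow {1..m}. \<Sum>J | J \<subseteq> {2..n} \<and> card J = k. set_weight A *
      (edge_prob A ^ k * (1 - edge_prob A) ^ (n - 1 - k)))"
    unfolding sum.cartesian_product' by (simp only: fst_conv)
  also have "\<dots> = (\<Sum>A\<in>Pow {1..m}. real (n - 1 choose k) * (set_weight A *
      (edge_prob A ^ k * (1 - edge_prob A) ^ (n - 1 - k))))"
    using n_subsets[of "{2..n}" k] assms by simp
  also have "\<dots> = set_average (\<lambda>A. binomial_weight (n - 1) (edge_prob A) k)"
    unfolding set_average_def binomial_weight_def by (simp only: mult_ac)
  finally show ?thesis .
qed

end

section \<open>Edge probabilities\<close>

lemma scaled_size_nonneg: "0 \<le> scaled_size n m s A"
  by (simp add: scaled_size_def)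

lemma scaled_size_mult:
  "scaled_size n m s A * scaled_size n m s B
    = real n * real (card A choose s) * real (card B choose s) / real (m choose s)"
proof -
  have "real (m choose s) powr (- 1 / 2) * real (m choose s) powr (- 1 / 2) = 1 / real (m choose s)"
    by (simp add: powr_add[symmetric] powr_minus_divide)
  moreover have "real n powr (1 / 2) * real n powr (1 / 2) = real n"
    by (simp add: powr_add[symmetric])
  moreover have "scaled_size n m s A * scaled_size n m s B =
      (real (m choose s) powr (- 1 / 2) * real (m choose s) powr (- 1 / 2))
      * (real n powr (1 / 2) * real n powr (1 / 2))
      * (real (card A choose s) * real (card B choose s))"
    by (simp add: scaled_size_def mult_ac)
  ultimately show ?thesis by simp
qed

lemma le_powr_inverse:
  fixes x y :: real
  assumes "0 \<le> x" "x ^ k \<le> y" "0 < k"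
  shows "x \<le> y powr (1 / real k)"
proof (cases "x = 0")
  case False
  then have "x = (x powr real k) powr (1 / real k)"
    using assms by (simp add: powr_powr)
  also have "x powr real k = x ^ k"
    using assms False by (intro powr_realpow) simp
  also have "(x ^ k) powr (1 / real k) \<le> y powr (1 / real k)"
    using assms by (intro powr_mono2) auto
  finally show ?thesis .
qed simp

text \<open>Used with \<open>k = Suc s\<close>, \<open>c'\<close> and \<open>a'\<close> the numbers
  of \<open>Suc s\<close>-subsets of the ground set and of \<open>A\<close>, and \<open>c\<close>,
  \<open>a\<close> their expressions through \<open>s\<close>-subsets. It passes from
  \<open>Suc s\<close> to \<open>s\<close> on both sides of the counting identity at once.\<close>

lemma ratio_transfer:
  fixes k S T :: real
  assumes "c' * S = a' * T" "k * c' = c" "k * a' = a" "c \<noteq> 0"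
  shows "k * S = a / c * (k * T)"
proof -
  have "k * S * c = k * (k * (c' * S))" using assms(2) by (simp add: mult_ac)
  also have "\<dots> = a * (k * T)" unfolding assms(1) assms(3)[symmetric] by (simp only: mult_ac)
  finally show ?thesis using assms(4) by (simp add: eq_divide_eq)
qed

text \<open>The estimate of the excess ratio is a function of the product \<open>u\<close> of the
  two scaled sizes alone, so a bound on both scaled sizes controls it uniformly.\<close>

definition size_product_bound :: "nat \<Rightarrow> nat \<Rightarrow> nat \<Rightarrow> real \<Rightarrow> real" where
  "size_product_bound n m s u = real m / real (m - s) * (u * fact s / real n) powr (1 / real s)"

context active_random_intersection_graph begin

abbreviation "z \<equiv> scaled_size n m s"

text \<open>The subtractions truncate; this is harmless because \<open>z\<close> vanishes below size \<open>s\<close>.\<close>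

abbreviation "excess_ratio x y \<equiv> real (x - s) * real (y - s) / real (m - s)"

text \<open>The counting identity with \<open>t = s\<close>; the factor
  \<open>n / (m choose s)\<close> is what two copies of the normalisation of \<open>z\<close>
  multiply to. The weight \<open>g\<close> is left arbitrary so that a cutoff in the size of
  \<open>B\<close> can later be put into it.\<close>

lemma sum_choose_Int_s:
  assumes "A \<subseteq> {1..m}"
  shows "real n * (\<Sum>B\<in>Pow {1..m}. g (card B) * real (card (A \<inter> B) choose s))
    = (\<Sum>B\<in>Pow {1..m}. g (card B) * (z A * z B))"
proof -
  have "real (m choose s) > 0" using s_bounds by simp
  moreover have "real (m choose s) * (\<Sum>B\<in>Pow {1..m}. g (card B) * real (card (A \<inter> B) choose s))
      = real (card A choose s) * (\<Sum>B\<in>Pow {1..m}. g (card B) * real (card B choose s))"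
    using sum_Pow_choose_Int_symmetric[OF _ assms, of s g] by simp
  ultimately have "(\<Sum>B\<in>Pow {1..m}. g (card B) * real (card (A \<inter> B) choose s))
      = real (card A choose s) / real (m choose s) * (\<Sum>B\<in>Pow {1..m}. g (card B) * real (card B choose s))"
    by (simp add: field_simps)
  then show ?thesis
    unfolding scaled_size_mult by (simp add: sum_distrib_left mult_ac)
qed

text \<open>The same identity with \<open>t = Suc s\<close>. Writing
  \<open>Suc s * (h choose Suc s)\<close> as \<open>(h - s) * (h choose s)\<close> for
  \<open>A\<close>, \<open>B\<close> and the ground set brings back the product of scaled sizes, and
  the three factors left over form the excess ratio.\<close>

lemma sum_choose_Int_Suc:
  assumes "A \<subseteq> {1..m}" "s < m"
  shows "real n * (\<Sum>B\<in>Pow {1..m}. g (card B) * (real (Suc s) * real (card (A \<inter> B) choose Suc s)))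
    = (\<Sum>B\<in>Pow {1..m}. g (card B) * (z A * z B * excess_ratio (card A) (card B)))"
proof -
  have Suc_times: "real (Suc s) * real (h choose Suc s) = real (h - s) * real (h choose s)" for h
    using Suc_times_binomial_Suc[of s h] by (metis of_nat_mult)
  let ?S = "\<Sum>B\<in>Pow {1..m}. g (card B) * real (card (A \<inter> B) choose Suc s)"
  let ?T = "\<Sum>B\<in>Pow {1..m}. g (card B) * real (card B choose Suc s)"
  have pos: "real (m - s) * real (m choose s) > 0" using assms by simp
  have "real (m choose Suc s) * ?S = real (card A choose Suc s) * ?T"
    using sum_Pow_choose_Int_symmetric[OF _ assms(1), of "Suc s" g] by simp
  then have "real (Suc s) * ?S = real (card A - s) * real (card A choose s)
      / (real (m - s) * real (m choose s)) * (real (Suc s) * ?T)"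
    using pos by (intro ratio_transfer[OF _ Suc_times Suc_times]) auto
  also have "real (Suc s) * ?T = (\<Sum>B\<in>Pow {1..m}. g (card B) * (real (card B - s) * real (card B choose s)))"
    unfolding Suc_times[symmetric] sum_distrib_left by (simp only: mult_ac)
  also have "real (Suc s) * ?S
      = (\<Sum>B\<in>Pow {1..m}. g (card B) * (real (Suc s) * real (card (A \<inter> B) choose Suc s)))"
    by (simp only: sum_distrib_left mult_ac)
  finally have "real n * (\<Sum>B\<in>Pow {1..m}. g (card B) * (real (Suc s) * real (card (A \<inter> B) choose Suc s)))
     = real n * (real (card A - s) * real (card A choose s) / (real (m - s) * real (m choose s)) *
      (\<Sum>B\<in>Pow {1..m}. g (card B) * (real (card B - s) * real (card B choose s))))"
    by simp
  then show ?thesis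
    unfolding scaled_size_mult by (simp add: sum_distrib_left mult_ac del: of_nat_diff of_nat_Suc)
qed

lemma sum_edge_upper:
  assumes "A \<subseteq> {1..m}" "\<And>j. 0 \<le> g j"
  shows "(\<Sum>B\<in>Pow {1..m}. g (card B) * (real n * of_bool (s \<le> card (A \<inter> B))))
    \<le> (\<Sum>B\<in>Pow {1..m}. g (card B) * (z A * z B))"
proof -
  have "(\<Sum>B\<in>Pow {1..m}. g (card B) * (real n * of_bool (s \<le> card (A \<inter> B))))
      \<le> (\<Sum>B\<in>Pow {1..m}. g (card B) * (real n * real (card (A \<inter> B) choose s)))"
    by (intro sum_mono mult_left_mono of_bool_le_choose assms) auto
  also have "\<dots> = real n * (\<Sum>B\<in>Pow {1..m}. g (card B) * real (card (A \<inter> B) choose s))"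
    by (simp only: sum_distrib_left mult_ac)
  finally show ?thesis by (simp only: sum_choose_Int_s[OF assms(1)])
qed

lemma sum_edge_lower:
  assumes "A \<subseteq> {1..m}" "s < m" "\<And>j. 0 \<le> g j"
  shows "(\<Sum>B\<in>Pow {1..m}. g (card B) * (z A * z B))
      - (\<Sum>B\<in>Pow {1..m}. g (card B) * (z A * z B * excess_ratio (card A) (card B)))
    \<le> (\<Sum>B\<in>Pow {1..m}. g (card B) * (real n * of_bool (s \<le> card (A \<inter> B))))"
proof -
  have "(\<Sum>B\<in>Pow {1..m}. g (card B) * (z A * z B))
      - (\<Sum>B\<in>Pow {1..m}. g (card B) * (z A * z B * excess_ratio (card A) (card B)))
    = (\<Sum>B\<in>Pow {1..m}. g (card B) * (real n * (real (card (A \<inter> B) choose s)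
        - real (Suc s) * real (card (A \<inter> B) choose Suc s))))"
    unfolding sum_choose_Int_s[OF assms(1), symmetric] sum_choose_Int_Suc[OF assms(1,2), symmetric]
    by (simp only: sum_distrib_left sum_subtractf right_diff_distrib mult_ac)
  also have "\<dots> \<le> (\<Sum>B\<in>Pow {1..m}. g (card B) * (real n * of_bool (s \<le> card (A \<inter> B))))"
    by (intro sum_mono mult_left_mono of_bool_ge_choose assms) auto
  finally show ?thesis .
qed

text \<open>The factor is \<open>n\<close> although a vertex has only \<open>n - 1\<close> possible
  neighbours; this gives the exact comparison with \<open>z A * z B\<close>, and the surplus
  \<open>edge_prob A\<close> is charged in \<open>degree_approx\<close>.\<close>

definition edge_deficit :: "nat set \<Rightarrow> real" where
  "edge_deficit A = z A * set_average z - real n * edge_prob A"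

lemma edge_deficit_eq:
  "edge_deficit A = set_average (\<lambda>B. z A * z B - real n * of_bool (s \<le> card (A \<inter> B)))"
  unfolding edge_deficit_def edge_prob_def
  by (simp add: set_average_diff set_average_cmult del: of_nat_diff)

lemma edge_deficit_nonneg:
  assumes "A \<subseteq> {1..m}"
  shows "0 \<le> edge_deficit A"
  using sum_edge_upper[OF assms, of "\<lambda>j. pmf P j / real (m choose j)"]
  unfolding edge_deficit_eq set_average_def set_weight_def
  by (simp add: right_diff_distrib sum_subtractf)

lemma edge_deficit_le:
  assumes "A \<subseteq> {1..m}" "s < m"
  shows "edge_deficit A \<le> set_average (\<lambda>B. z A * z B * min 1 (excess_ratio (card A) (card B)))"
proof -
  let ?r = "excess_ratio (card A)"
  let ?w = "\<lambda>j. pmf P j / real (m choose j)"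
  \<comment> \<open>the minimum comes from using the lower bound only for sizes of \<open>B\<close> with ratio at most 1\<close>
  let ?g = "\<lambda>j. ?w j * of_bool (?r j \<le> 1)"
  let ?h = "\<lambda>j. ?w j * of_bool (\<not> ?r j \<le> 1)"
  have "edge_deficit A
      = (\<Sum>B\<in>Pow {1..m}. ?g (card B) * (z A * z B - real n * of_bool (s \<le> card (A \<inter> B))))
      + (\<Sum>B\<in>Pow {1..m}. ?h (card B) * (z A * z B - real n * of_bool (s \<le> card (A \<inter> B))))"
    unfolding edge_deficit_eq set_average_def set_weight_def sum.distrib[symmetric]
    by (intro sum.cong) auto
  also have "\<dots> \<le> (\<Sum>B\<in>Pow {1..m}. ?g (card B) * (z A * z B * ?r (card B)))
      + (\<Sum>B\<in>Pow {1..m}. ?h (card B) * (z A * z B))"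
  proof (rule add_mono)
    show "(\<Sum>B\<in>Pow {1..m}. ?g (card B) * (z A * z B - real n * of_bool (s \<le> card (A \<inter> B))))
        \<le> (\<Sum>B\<in>Pow {1..m}. ?g (card B) * (z A * z B * ?r (card B)))"
      using sum_edge_lower[OF assms, of ?g]
      unfolding right_diff_distrib sum_subtractf by simp
    have "0 \<le> (\<Sum>B\<in>Pow {1..m}. ?h (card B) * (real n * of_bool (s \<le> card (A \<inter> B))))"
      by (intro sum_nonneg) auto
    then show "(\<Sum>B\<in>Pow {1..m}. ?h (card B) * (z A * z B - real n * of_bool (s \<le> card (A \<inter> B))))
        \<le> (\<Sum>B\<in>Pow {1..m}. ?h (card B) * (z A * z B))"
      unfolding right_diff_distrib sum_subtractf by simp
  qed
  also have "\<dots> = set_average (\<lambda>B. z A * z B * min 1 (?r (card B)))"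
    unfolding set_average_def set_weight_def sum.distrib[symmetric]
    by (intro sum.cong) (auto simp: min_def)
  finally show ?thesis .
qed

text \<open>The \<open>s\<close>-th power of \<open>(|A| - s) (|B| - s)\<close> is at most the
  product of the two falling factorials of length \<open>s\<close>. By the formula for
  \<open>z A * z B\<close> this is \<open>z A * z B * fact s / n\<close> times the falling factorial
  of \<open>m\<close>, which is at most \<open>m ^ s\<close>. Taking \<open>s\<close>-th roots
  leaves the factor \<open>m\<close>.\<close>

lemma excess_ratio_le:
  assumes "s < m" "0 < n"
  shows "excess_ratio (card A) (card B) \<le> size_product_bound n m s (z A * z B)"
proof -
  let ?x = "real (card A - s) * real (card B - s)"
  let ?u = "z A * z B * fact s / real n"
  have pow: "real (k - s) ^ s \<le> fact s * real (k choose s)" for k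
    using power_diff_le_fact_choose[of k s]
    by (metis of_nat_fact of_nat_le_iff of_nat_mult of_nat_power)
  have choose: "0 < real (m choose s)" using assms by simp
  have choose_le: "fact s * real (m choose s) \<le> real m ^ s"
    using binomial_fact_pow[of m s]
    by (metis mult.commute of_nat_fact of_nat_le_iff of_nat_mult of_nat_power)
  have u: "0 \<le> ?u" by (simp add: scaled_size_nonneg)
  have "?x ^ s \<le> (fact s * real (card A choose s)) * (fact s * real (card B choose s))"
    unfolding power_mult_distrib by (intro mult_mono pow) auto
  also have "\<dots> = ?u * (fact s * real (m choose s))"
    using choose assms unfolding scaled_size_mult by (simp add: field_simps)
  also have "\<dots> \<le> ?u * real m ^ s"
    by (rule mult_left_mono[OF choose_le u])
  finally have "?x \<le> (?u * real m ^ s) powr (1 / real s)"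
    by (rule le_powr_inverse[rotated]) (use s_bounds in auto)
  also have "\<dots> = ?u powr (1 / real s) * (real m powr real s) powr (1 / real s)"
    using assms u by (simp only: powr_mult powr_realpow of_nat_0_less_iff of_nat_0_le_iff)
  also have "\<dots> = ?u powr (1 / real s) * real m"
    using s_bounds by (simp add: powr_powr)
  finally have "?x / real (m - s) \<le> ?u powr (1 / real s) * real m / real (m - s)"
    by (rule divide_right_mono) simp
  then show ?thesis
    unfolding size_product_bound_def by (simp only: mult_ac times_divide_eq_right times_divide_eq_left)
qed

section \<open>Truncation of the deficit and comparison of the degree with a Poisson mixture\<close>

definition truncated_error :: "real \<Rightarrow> nat set \<Rightarrow> nat set \<Rightarrow> real" where
  "truncated_error K A B =
    of_bool (z A \<le> K \<and> z B \<le> K) * (z A * z B * min 1 (size_product_bound n m s (z A * z B)))"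

definition size_tail :: "real \<Rightarrow> real" where
  "size_tail K = set_average (\<lambda>A. z A * of_bool (K < z A))"

text \<open>A pair with \<open>z A > K\<close> is charged its full product \<open>z A * z B\<close>.
  The double average of this factorises into \<open>size_tail K\<close> times the mean of
  \<open>z\<close>; the pairs with \<open>z B > K\<close> cost the same, whence the factor
  2.\<close>

lemma set_average_edge_deficit_le:
  assumes "s < m" "0 < n"
  shows "set_average edge_deficit
    \<le> 2 * set_average z * size_tail K + set_average (\<lambda>A. set_average (truncated_error K A))"
proof -
  have split: "q' \<le> a * of_bool (K < a) * b + a * (b * of_bool (K < b)) + of_bool (a \<le> K \<and> b \<le> K) * q"
    if "q' \<le> q" "q \<le> a * b" "0 \<le> q" "0 \<le> a * b" for a b q q' :: real
    using that by (cases "a \<le> K"; cases "b \<le> K") (simp_all add: not_le)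
  have le: "z A * z B * min 1 (excess_ratio (card A) (card B))
      \<le> z A * of_bool (K < z A) * z B + z A * (z B * of_bool (K < z B)) + truncated_error K A B" for A B
  proof -
    have zz: "0 \<le> z A * z B" by (simp add: scaled_size_nonneg)
    have "z A * z B * min 1 (excess_ratio (card A) (card B))
        \<le> z A * z B * min 1 (size_product_bound n m s (z A * z B))"
      using excess_ratio_le[OF assms, of A B] zz by (intro mult_left_mono min.mono order_refl)
    moreover have "z A * z B * min 1 (size_product_bound n m s (z A * z B)) \<le> z A * z B"
      using zz by (simp add: mult_left_le)
    moreover have "0 \<le> z A * z B * min 1 (size_product_bound n m s (z A * z B))"
      using zz by (simp add: size_product_bound_def)
    ultimately show ?thesis
      unfolding truncated_error_def using zz by (rule split)
  qed
  have "set_average edge_deficit \<le> set_average (\<lambda>A. set_average (\<lambda>B.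
      z A * of_bool (K < z A) * z B + z A * (z B * of_bool (K < z B)) + truncated_error K A B))"
  proof (rule set_average_mono)
    fix A assume A: "A \<subseteq> {1..m}"
    show "edge_deficit A \<le> set_average (\<lambda>B.
        z A * of_bool (K < z A) * z B + z A * (z B * of_bool (K < z B)) + truncated_error K A B)"
      by (rule order_trans[OF edge_deficit_le[OF A assms(1)]]) (rule set_average_mono, rule le)
  qed
  also have "\<dots> = 2 * set_average z * size_tail K
      + set_average (\<lambda>A. set_average (truncated_error K A))"
    by (simp only: size_tail_def set_average_add set_average_cmult set_average_multc) algebra
  finally show ?thesis .
qed

text \<open>Three replacements for fixed \<open>A\<close>: binomial by Poisson with mean
  \<open>(n - 1) * edge_prob A\<close>, then this mean by \<open>z A\<close> times the mean of
  \<open>z\<close>, then the mean of \<open>z\<close> by \<mu>. Each error is linear in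
  \<open>z A\<close> or equals the deficit, so averaging asks for no higher moment of
  \<open>z\<close>.\<close>

lemma degree_approx:
  assumes "1 \<le> n" "0 \<le> \<mu>"
  shows "\<bar>prob {\<omega> \<in> space M. rig_degree n s (\<lambda>i. D i \<omega>) 1 = k}
      - set_average (\<lambda>A. poisson_weight k (z A * \<mu>))\<bar>
    \<le> (sqrt (2 * real n) + 1) / real n * (set_average z)\<^sup>2 + set_average edge_deficit
      + set_average z * \<bar>set_average z - \<mu>\<bar>"
proof -
  let ?e = "set_average z"
  let ?c = "(sqrt (2 * real n) + 1) / real n"
  have e: "0 \<le> ?e" by (rule set_average_nonneg) (rule scaled_size_nonneg)
  have pointwise: "\<bar>binomial_weight (n - 1) (edge_prob A) k - poisson_weight k (z A * \<mu>)\<bar>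
      \<le> ?c * ?e * z A + edge_deficit A + z A * \<bar>?e - \<mu>\<bar>" if "A \<subseteq> {1..m}" for A
  proof -
    let ?p = "edge_prob A"
    have p: "0 \<le> ?p" "?p \<le> 1" by (rule edge_prob_nonneg, rule edge_prob_le_1)
    have d: "0 \<le> edge_deficit A" by (rule edge_deficit_nonneg[OF that])
    have zA: "0 \<le> z A" by (rule scaled_size_nonneg)
    have "\<bar>binomial_weight (n - 1) ?p k - poisson_weight k (real (n - 1) * ?p)\<bar>
        \<le> sqrt (2 * real (n - 1)) * ?p"
      by (rule binomial_poisson_approx_sqrt[OF p])
    also have "\<dots> \<le> sqrt (2 * real n) * ?p"
      using p by (intro mult_right_mono) auto
    finally have 1: "\<bar>binomial_weight (n - 1) ?p k - poisson_weight k (real (n - 1) * ?p)\<bar>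
        \<le> sqrt (2 * real n) * ?p" .
    have "\<bar>poisson_weight k (real (n - 1) * ?p) - poisson_weight k (z A * ?e)\<bar>
        \<le> \<bar>real (n - 1) * ?p - z A * ?e\<bar>"
      by (rule poisson_weight_lipschitz) (use p zA e in auto)
    also have "\<dots> \<le> ?p + edge_deficit A"
    proof -
      \<comment> \<open>Passing from \<open>n - 1\<close> to \<open>n\<close> costs one
        \<open>?p\<close>; the rest of the gap is the deficit by definition.\<close>
      have "real (n - 1) * ?p - z A * ?e = - (?p + edge_deficit A)"
        unfolding edge_deficit_def of_nat_diff[OF assms(1)] of_nat_1 left_diff_distrib by linarith
      then show ?thesis using p d by simp
    qed
    finally have 2: "\<bar>poisson_weight k (real (n - 1) * ?p) - poisson_weight k (z A * ?e)\<bar>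
        \<le> ?p + edge_deficit A" .
    have "\<bar>poisson_weight k (z A * ?e) - poisson_weight k (z A * \<mu>)\<bar> \<le> \<bar>z A * ?e - z A * \<mu>\<bar>"
      by (rule poisson_weight_lipschitz) (use zA e assms in auto)
    also have "\<dots> = z A * \<bar>?e - \<mu>\<bar>"
      using zA by (simp add: abs_mult flip: right_diff_distrib)
    finally have 3: "\<bar>poisson_weight k (z A * ?e) - poisson_weight k (z A * \<mu>)\<bar> \<le> z A * \<bar>?e - \<mu>\<bar>" .
    \<comment> \<open>Nonnegativity of the deficit bounds the edge probability by
      \<open>z A * ?e / n\<close>, which absorbs both the Poisson error and the extra
      \<open>?p\<close> into a term of order \<open>n^(-1/2)\<close>.\<close>
    have "?p * real n \<le> z A * ?e" "0 < real n"
      using d assms(1) unfolding edge_deficit_def by (simp_all add: mult.commute)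
    then have "?p \<le> z A * ?e / real n"
      by (simp only: pos_le_divide_eq)
    then have "(sqrt (2 * real n) + 1) * ?p \<le> (sqrt (2 * real n) + 1) * (z A * ?e / real n)"
      by (intro mult_left_mono) auto
    then have "sqrt (2 * real n) * ?p + ?p \<le> ?c * ?e * z A"
      by (simp only: distrib_right[of "sqrt (2 * real n)" 1 ?p] mult_1)
        (simp only: times_divide_eq_left times_divide_eq_right mult_ac)
    then show ?thesis using 1 2 3 by linarith
  qed
  have "\<bar>prob {\<omega> \<in> space M. rig_degree n s (\<lambda>i. D i \<omega>) 1 = k}
      - set_average (\<lambda>A. poisson_weight k (z A * \<mu>))\<bar>
    = \<bar>set_average (\<lambda>A. binomial_weight (n - 1) (edge_prob A) k - poisson_weight k (z A * \<mu>))\<bar>"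
    by (simp only: prob_degree[OF assms(1)] set_average_diff)
  also have "\<dots> \<le> set_average (\<lambda>A. ?c * ?e * z A + edge_deficit A + z A * \<bar>?e - \<mu>\<bar>)"
    by (rule order_trans[OF set_average_abs]) (rule set_average_mono, rule pointwise)
  also have "\<dots> = ?c * ?e\<^sup>2 + set_average edge_deficit + ?e * \<bar>?e - \<mu>\<bar>"
    by (simp only: set_average_add set_average_cmult set_average_multc power2_eq_square mult.assoc)
  finally show ?thesis .
qed

end

section \<open>Weak convergence and truncation\<close>

text \<open>The spaces are probability spaces only from some index \<open>m0\<close> on, so the
  continuous mapping of laws to integrals is applied to the sequence shifted by \<open>m0\<close>,
  and the shift is undone at the end.\<close>

lemma weak_conv_integral_bounded:
  fixes X :: "nat \<Rightarrow> 'a \<Rightarrow> real" and Z :: "'b \<Rightarrow> real" and f :: "real \<Rightarrow> real"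
  assumes seq: "\<forall>\<^sub>F m in sequentially. prob_space (M m) \<and> X m \<in> borel_measurable (M m)"
    and Z: "prob_space N" "Z \<in> borel_measurable N"
    and conv: "weak_conv_m (\<lambda>m. distr (M m) borel (X m)) (distr N borel Z)"
    and f: "continuous_on UNIV f" "\<And>x. \<bar>f x\<bar> \<le> B"
  shows "(\<lambda>m. \<integral>\<omega>. f (X m \<omega>) \<partial>M m) \<longlonglongrightarrow> (\<integral>\<omega>. f (Z \<omega>) \<partial>N)"
proof -
  obtain m0 where m0: "\<And>m. m \<ge> m0 \<Longrightarrow> prob_space (M m) \<and> X m \<in> borel_measurable (M m)"
    using seq unfolding eventually_sequentially by blast
  have f_meas: "f \<in> borel_measurable borel"
    using f(1) by (rule borel_measurable_continuous_onI)
  have "(\<lambda>m. integral\<^sup>L (distr (M (m + m0)) borel (X (m + m0))) f) \<longlonglongrightarrow> integral\<^sup>L (distr N borel Z) f"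
  proof (rule weak_conv_imp_integral_bdd_continuous_conv)
    show "real_distribution (distr (M (m + m0)) borel (X (m + m0)))" for m
      using m0[of "m + m0"] by (intro prob_space.real_distribution_distr) auto
    show "real_distribution (distr N borel Z)"
      using Z by (intro prob_space.real_distribution_distr) auto
    show "weak_conv_m (\<lambda>m. distr (M (m + m0)) borel (X (m + m0))) (distr N borel Z)"
      using conv unfolding weak_conv_m_def weak_conv_def
      by (auto intro: LIMSEQ_ignore_initial_segment[where k = m0])
    show "isCont f x" for x
      using f(1) by (simp add: continuous_on_eq_continuous_at)
    show "norm (f x) \<le> B" for x
      using f(2) by simp
  qed
  moreover have "integral\<^sup>L (distr (M (m + m0)) borel (X (m + m0))) f
      = (\<integral>\<omega>. f (X (m + m0) \<omega>) \<partial>M (m + m0))" for m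
    using m0[of "m + m0"] f_meas by (intro integral_distr) auto
  moreover have "integral\<^sup>L (distr N borel Z) f = (\<integral>\<omega>. f (Z \<omega>) \<partial>N)"
    using Z f_meas by (intro integral_distr) auto
  ultimately have "(\<lambda>m. \<integral>\<omega>. f (X (m + m0) \<omega>) \<partial>M (m + m0)) \<longlonglongrightarrow> (\<integral>\<omega>. f (Z \<omega>) \<partial>N)"
    by simp
  then show ?thesis by (rule LIMSEQ_offset)
qed

text \<open>The bounded continuous test function \<open>min 1 (max 0 (- x))\<close> is zero exactly
  on the nonnegative reals. Its integral is 0 along the sequence, hence 0 in the limit.\<close>

lemma weak_limit_nonneg:
  fixes X :: "nat \<Rightarrow> 'a \<Rightarrow> real" and Z :: "'b \<Rightarrow> real"
  assumes seq: "\<forall>\<^sub>F m in sequentially. prob_space (M m) \<and> X m \<in> borel_measurable (M m)"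
    and Z: "prob_space N" "Z \<in> borel_measurable N"
    and conv: "weak_conv_m (\<lambda>m. distr (M m) borel (X m)) (distr N borel Z)"
    and nonneg: "\<And>m \<omega>. 0 \<le> X m \<omega>"
  shows "AE \<omega> in N. 0 \<le> Z \<omega>"
proof -
  interpret N: prob_space N by fact
  let ?f = "\<lambda>x::real. min 1 (max 0 (- x))"
  have "(\<lambda>m. \<integral>\<omega>. ?f (X m \<omega>) \<partial>M m) \<longlonglongrightarrow> (\<integral>\<omega>. ?f (Z \<omega>) \<partial>N)"
    by (rule weak_conv_integral_bounded[OF seq Z conv, where B = 1]) (auto intro!: continuous_intros)
  moreover have "(\<integral>\<omega>. ?f (X m \<omega>) \<partial>M m) = 0" for m
  proof -
    have "?f (X m \<omega>) = 0" for \<omega> using nonneg[of m \<omega>] by (simp add: max_absorb1)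
    then show ?thesis by (simp only: Bochner_Integration.integral_zero)
  qed
  ultimately have "(\<integral>\<omega>. ?f (Z \<omega>) \<partial>N) = 0"
    by (simp add: LIMSEQ_const_iff)
  moreover have "integrable N (\<lambda>\<omega>. ?f (Z \<omega>))"
    using Z(2) by (intro N.integrable_const_bound[where B = 1]) auto
  ultimately have "AE \<omega> in N. ?f (Z \<omega>) = 0"
    by (subst (asm) integral_nonneg_eq_0_iff_AE) auto
  then show ?thesis
    by eventually_elim linarith
qed

text \<open>Convergence of the means upgrades weak convergence to uniform integrability.\<close>

lemma weak_conv_mean_tail:
  fixes X :: "nat \<Rightarrow> 'a \<Rightarrow> real" and Z :: "'b \<Rightarrow> real"
  assumes seq: "\<forall>\<^sub>F m in sequentially. prob_space (M m) \<and> integrable (M m) (X m)"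
    and Z: "prob_space N" "integrable N Z"
    and conv: "weak_conv_m (\<lambda>m. distr (M m) borel (X m)) (distr N borel Z)"
    and nonneg: "\<And>m \<omega>. 0 \<le> X m \<omega>"
    and mean: "(\<lambda>m. integral\<^sup>L (M m) (X m)) \<longlonglongrightarrow> integral\<^sup>L N Z"
    and e: "0 < e"
  shows "\<exists>K>0. \<forall>\<^sub>F m in sequentially. (\<integral>\<omega>. X m \<omega> * of_bool (K < X m \<omega>) \<partial>M m) < e"
proof -
  interpret N: prob_space N by fact
  have Z_meas: "Z \<in> borel_measurable N" using Z(2) by simp
  have seq': "\<forall>\<^sub>F m in sequentially. prob_space (M m) \<and> X m \<in> borel_measurable (M m)"
    using seq by eventually_elim auto
  have Z_nonneg: "AE \<omega> in N. 0 \<le> Z \<omega>"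
    by (rule weak_limit_nonneg[OF seq' Z(1) Z_meas conv nonneg])
  \<comment> \<open>Clamping to the interval from 0 to \<open>K\<close> is bounded and continuous,
    so weak convergence applies to it. The inner \<open>max\<close> is needed because
    \<open>Z\<close> is nonnegative only almost everywhere.\<close>
  let ?g = "\<lambda>K x::real. min (max x 0) K"
  have "(\<lambda>j. \<integral>\<omega>. ?g (real j) (Z \<omega>) \<partial>N) \<longlonglongrightarrow> (\<integral>\<omega>. Z \<omega> \<partial>N)"
  proof (rule integral_dominated_convergence[where w = "\<lambda>\<omega>. \<bar>Z \<omega>\<bar>"])
    show "AE \<omega> in N. (\<lambda>j. ?g (real j) (Z \<omega>)) \<longlonglongrightarrow> Z \<omega>"
      using Z_nonneg
    proof eventually_elim
      fix \<omega> assume z: "0 \<le> Z \<omega>"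
      obtain j0 where "Z \<omega> \<le> real j0" using real_arch_simple by blast
      then have "\<forall>\<^sub>F j in sequentially. ?g (real j) (Z \<omega>) = Z \<omega>"
        using z by (intro eventually_sequentiallyI[of j0]) auto
      then show "(\<lambda>j. ?g (real j) (Z \<omega>)) \<longlonglongrightarrow> Z \<omega>" by (rule tendsto_eventually)
    qed
    show "AE \<omega> in N. norm (?g (real j) (Z \<omega>)) \<le> \<bar>Z \<omega>\<bar>" for j
    proof (rule AE_I2)
      have "0 \<le> ?g (real j) x" "?g (real j) x \<le> \<bar>x\<bar>" for x :: real
        by (auto intro: min.coboundedI1)
      then show "norm (?g (real j) (Z \<omega>)) \<le> \<bar>Z \<omega>\<bar>" for \<omega>
        by (simp only: real_norm_def abs_of_nonneg)
    qed
  qed (use Z Z_meas in simp_all)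
  then have "\<forall>\<^sub>F j in sequentially. dist (\<integral>\<omega>. ?g (real j) (Z \<omega>) \<partial>N) (\<integral>\<omega>. Z \<omega> \<partial>N) < e / 2"
    using e by (intro tendstoD) auto
  then have "\<forall>\<^sub>F j in sequentially. 0 < j \<and> dist (\<integral>\<omega>. ?g (real j) (Z \<omega>) \<partial>N) (\<integral>\<omega>. Z \<omega> \<partial>N) < e / 2"
    using eventually_gt_at_top[of 0] by (rule eventually_conj[rotated])
  from eventually_happens'[OF sequentially_bot this]
  obtain j where j: "0 < j" "dist (\<integral>\<omega>. ?g (real j) (Z \<omega>) \<partial>N) (\<integral>\<omega>. Z \<omega> \<partial>N) < e / 2"
    by blast
  define K where "K = real j"
  have K: "0 < K" "(\<integral>\<omega>. Z \<omega> \<partial>N) - (\<integral>\<omega>. ?g K (Z \<omega>) \<partial>N) < e / 2"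
    using j unfolding K_def dist_real_def by (simp, linarith)
  have "(\<lambda>m. \<integral>\<omega>. ?g K (X m \<omega>) \<partial>M m) \<longlonglongrightarrow> (\<integral>\<omega>. ?g K (Z \<omega>) \<partial>N)"
    using K by (intro weak_conv_integral_bounded[OF seq' Z(1) Z_meas conv, where B = K])
      (auto intro!: continuous_intros)
  then have "(\<lambda>m. integral\<^sup>L (M m) (X m) - (\<integral>\<omega>. ?g K (X m \<omega>) \<partial>M m))
      \<longlonglongrightarrow> (\<integral>\<omega>. Z \<omega> \<partial>N) - (\<integral>\<omega>. ?g K (Z \<omega>) \<partial>N)"
    using mean by (intro tendsto_diff)
  then have ev: "\<forall>\<^sub>F m in sequentially. integral\<^sup>L (M m) (X m) - (\<integral>\<omega>. ?g K (X m \<omega>) \<partial>M m) < e / 2"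
    using K(2) by (rule order_tendstoD)
  have "\<forall>\<^sub>F m in sequentially. (\<integral>\<omega>. X m \<omega> * of_bool (2 * K < X m \<omega>) \<partial>M m) < e"
    using ev seq
  proof eventually_elim
    fix m assume lt: "integral\<^sup>L (M m) (X m) - (\<integral>\<omega>. ?g K (X m \<omega>) \<partial>M m) < e / 2"
      and m: "prob_space (M m) \<and> integrable (M m) (X m)"
    interpret prob_space "M m" using m by simp
    have [measurable]: "X m \<in> borel_measurable (M m)"
      using m borel_measurable_integrable by blast
    have int: "integrable (M m) (X m)" "integrable (M m) (\<lambda>\<omega>. ?g K (X m \<omega>))"
      using m K(1) by (simp, intro integrable_const_bound[where B = K]) auto
    \<comment> \<open>The tail function jumps and is unbounded. Cutting at \<open>2 * K\<close>
      rather than \<open>K\<close> lets it be dominated by twice the excess of \<open>X\<close> over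
      its clamped version, since \<open>x > 2 * K\<close> gives \<open>x <= 2 * (x - K)\<close>; the
      mean of that excess converges.\<close>
    have "(\<integral>\<omega>. X m \<omega> * of_bool (2 * K < X m \<omega>) \<partial>M m) \<le> (\<integral>\<omega>. 2 * (X m \<omega> - ?g K (X m \<omega>)) \<partial>M m)"
    proof (rule integral_mono)
      show "integrable (M m) (\<lambda>\<omega>. X m \<omega> * of_bool (2 * K < X m \<omega>))"
      proof (rule Bochner_Integration.integrable_bound[OF int(1)])
        show "(\<lambda>\<omega>. X m \<omega> * of_bool (2 * K < X m \<omega>)) \<in> borel_measurable (M m)"
          unfolding of_bool_def by measurable
      qed (simp add: of_bool_def)
      show "X m \<omega> * of_bool (2 * K < X m \<omega>) \<le> 2 * (X m \<omega> - ?g K (X m \<omega>))" for \<omega>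
      proof (cases "2 * K < X m \<omega>")
        case True
        moreover have "?g K (X m \<omega>) \<le> K" by simp
        ultimately show ?thesis by simp
      next
        case False
        moreover have "?g K (X m \<omega>) \<le> X m \<omega>"
          using nonneg[of m \<omega>] by (simp add: min.coboundedI1)
        ultimately show ?thesis by simp
      qed
    qed (use int in auto)
    also have "\<dots> = 2 * (integral\<^sup>L (M m) (X m) - (\<integral>\<omega>. ?g K (X m \<omega>) \<partial>M m))"
      using int by simp
    also have "\<dots> < 2 * (e / 2)"
      by (rule mult_strict_left_mono[OF lt]) simp
    finally show "(\<integral>\<omega>. X m \<omega> * of_bool (2 * K < X m \<omega>) \<partial>M m) < e"
      by simp
  qed
  then show ?thesis using K(1) by (intro exI[of _ "2 * K"]) auto
qed

text \<open>With \<open>t = 1 / s\<close>, \<open>F\<close> the factorial of \<open>s\<close> and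
  \<open>N = n\<close>, the exponent \<open>1 + t\<close> is the \<open>(s + 1) / s\<close> of
  hypothesis (iii).\<close>

lemma powr_regroup:
  fixes u c F N t :: real
  assumes "0 \<le> u" "0 < N" "0 \<le> F"
  shows "u * (c * (u * F / N) powr t) / N = c * (F powr t / N powr (1 + t) * u powr (1 + t))"
proof -
  have "(u * F / N) powr t = u powr t * F powr t / N powr t"
    using assms by (simp add: powr_mult powr_divide)
  moreover have "N powr (1 + t) = N * N powr t" "u powr (1 + t) = u * u powr t"
    using assms by (cases "u = 0", simp_all add: powr_add)
  ultimately show ?thesis by (simp add: mult_ac)
qed

section \<open>Smallness of the truncated error, in probability and for bounded
  \<open>s\<close>\<close>

context active_random_intersection_graph begin

text \<open>The quantity of hypothesis (iii).\<close>

definition normalized_sum :: "'a \<Rightarrow> real" where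
  "normalized_sum \<omega> = fact s powr (1 / real s) / real n powr ((real s + 1) / real s)
    * (\<Sum>k = 2..n. (z (D 1 \<omega>) * z (D k \<omega>)) powr ((real s + 1) / real s))"

lemma truncated_error_nonneg: "0 \<le> truncated_error K A B"
  unfolding truncated_error_def size_product_bound_def
  by (intro mult_nonneg_nonneg min.boundedI scaled_size_nonneg divide_nonneg_nonneg powr_ge_zero) simp_all

lemma size_product_le_square:
  assumes "z A \<le> K" "z B \<le> K"
  shows "z A * z B \<le> K\<^sup>2"
proof -
  have "0 \<le> z A" "0 \<le> z B" by (rule scaled_size_nonneg)+
  then show ?thesis
    unfolding power2_eq_square using assms by (intro mult_mono) simp_all
qed

lemma truncated_error_cases:
  obtains "z A \<le> K" "z B \<le> K"
    "truncated_error K A B = z A * z B * min 1 (size_product_bound n m s (z A * z B))"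
  | "truncated_error K A B = 0"
proof (cases "z A \<le> K \<and> z B \<le> K")
  case True
  then show ?thesis
    by (intro that(1)) (simp_all only: truncated_error_def of_bool_eq mult_1 simp_thms)
next
  case False
  then show ?thesis
    by (intro that(2)) (simp only: truncated_error_def of_bool_eq mult_zero_left)
qed

lemma truncated_error_le_square: "truncated_error K A B \<le> K\<^sup>2"
proof (cases rule: truncated_error_cases[of A K B])
  case 1
  have u: "0 \<le> z A * z B" by (intro mult_nonneg_nonneg scaled_size_nonneg)
  have "truncated_error K A B \<le> z A * z B"
    unfolding 1(3) by (rule mult_left_le[OF min.cobounded1 u])
  also have "\<dots> \<le> K\<^sup>2" by (rule size_product_le_square[OF 1(1,2)])
  finally show ?thesis .
qed (simp only: zero_le_power2)

text \<open>Keeping the second argument of the minimum and dividing by \<open>n\<close> gives, up to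
  the constant \<open>c\<close>, precisely one summand of \<open>normalized_sum\<close>.\<close>

lemma truncated_error_le_powr:
  assumes "real m / real (m - s) \<le> c" "0 < n"
  shows "truncated_error K A B / real n \<le> c * (fact s powr (1 / real s)
    / real n powr ((real s + 1) / real s) * (z A * z B) powr ((real s + 1) / real s))"
proof -
  let ?u = "z A * z B" and ?t = "1 / real s"
  have s0: "0 < s" using s_bounds by simp
  have u: "0 \<le> ?u" by (intro mult_nonneg_nonneg scaled_size_nonneg)
  have exponent: "(real s + 1) / real s = 1 + ?t" using s0 by (simp add: field_simps)
  have "truncated_error K A B \<le> ?u * size_product_bound n m s ?u"
  proof (cases rule: truncated_error_cases[of A K B])
    case 1
    show ?thesis unfolding 1(3) by (rule mult_left_mono[OF min.cobounded2 u])
  next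
    case 2
    show ?thesis unfolding 2 size_product_bound_def by (intro mult_nonneg_nonneg scaled_size_nonneg) simp_all
  qed
  also have "\<dots> \<le> ?u * (c * (?u * fact s / real n) powr ?t)"
    unfolding size_product_bound_def
    by (rule mult_left_mono[OF mult_right_mono[OF assms(1)] u]) simp
  finally have "truncated_error K A B / real n \<le> ?u * (c * (?u * fact s / real n) powr ?t) / real n"
    by (rule divide_right_mono) simp
  also have "\<dots> = c * (fact s powr ?t / real n powr (1 + ?t) * ?u powr (1 + ?t))"
    by (rule powr_regroup) (use u assms(2) in simp_all)
  finally show ?thesis unfolding exponent .
qed

lemma normalized_sum_measurable:
  assumes "1 \<le> n" shows "normalized_sum \<in> borel_measurable M"
proof -
  have meas: "(\<lambda>\<omega>. z (D k \<omega>)) \<in> borel_measurable M" if "k \<in> {1..n}" for k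
    using expectation_D(2)[OF that, of z] by (rule borel_measurable_integrable)
  have "(\<lambda>\<omega>. (z (D 1 \<omega>) * z (D k \<omega>)) powr ((real s + 1) / real s)) \<in> borel_measurable M"
    if "k \<in> {2..n}" for k
    by (intro powr_real_measurable borel_measurable_times meas measurable_const) (use that assms in auto)
  from borel_measurable_sum[OF this, of "{2..n}"] show ?thesis
    unfolding normalized_sum_def[abs_def] by (intro borel_measurable_times borel_measurable_const) simp
qed

text \<open>
  By exchangeability the mean of the truncated error over an independent pair is, up to a factor,
  the mean of its empirical average over the pairs \<open>(D 1, D k)\<close>; this average is bounded, so
  smallness in probability is enough.
\<close>

lemma set_average_truncated_error_le:
  assumes "real m / real (m - s) \<le> c" "0 < c" "2 \<le> n" "0 < e"
  shows "set_average (\<lambda>A. set_average (truncated_error K A))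
    \<le> 2 * (e + K\<^sup>2 * prob {\<omega> \<in> space M. e / c < \<bar>normalized_sum \<omega>\<bar>})"
proof -
  let ?a = "set_average (\<lambda>A. set_average (truncated_error K A))"
  define F where "F = {\<omega> \<in> space M. e / c < \<bar>normalized_sum \<omega>\<bar>}"
  let ?T = "\<lambda>k \<omega>. truncated_error K (D 1 \<omega>) (D k \<omega>) / real n"
  have n: "0 < real n" "1 \<in> {1..n}" using assms by auto
  have F: "F \<in> sets M"
  proof -
    have [measurable]: "normalized_sum \<in> borel_measurable M"
      using assms(3) by (intro normalized_sum_measurable) simp
    show ?thesis unfolding F_def by measurable
  qed
  have int: "integrable M (?T k)" and T: "expectation (?T k) = ?a / real n" if "k \<in> {2..n}" for k
    using that n expectation_D_pair[of 1 k "\<lambda>A B. truncated_error K A B"] by auto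
  have "expectation (\<lambda>\<omega>. \<Sum>k = 2..n. ?T k \<omega>) = (\<Sum>k = 2..n. expectation (?T k))"
    by (rule Bochner_Integration.integral_sum[OF int])
  also have "\<dots> = real (n - 1) * (?a / real n)"
    using T assms by simp
  finally have mean: "expectation (\<lambda>\<omega>. \<Sum>k = 2..n. ?T k \<omega>) = real (n - 1) * (?a / real n)" .
  \<comment> \<open>On the exceptional event \<open>F\<close> there are fewer than \<open>n\<close>
    terms, each at most \<open>K^2 / n\<close>; off \<open>F\<close> the sum is at most
    \<open>c\<close> times \<open>normalized_sum\<close>, which there is at most
    \<open>e / c\<close>.\<close>
  have bound: "(\<Sum>k = 2..n. ?T k \<omega>) \<le> e + K\<^sup>2 * indicator F \<omega>" if "\<omega> \<in> space M" for \<omega>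
  proof (cases "\<omega> \<in> F")
    case True
    have "(\<Sum>k = 2..n. ?T k \<omega>) \<le> (\<Sum>k = 2..n. K\<^sup>2 / real n)"
      by (intro sum_mono divide_right_mono truncated_error_le_square) simp
    also have "\<dots> = real (n - 1) / real n * K\<^sup>2"
      by simp
    also have "\<dots> \<le> 1 * K\<^sup>2"
      by (rule mult_right_mono) (use n in auto)
    also have "\<dots> \<le> e + K\<^sup>2 * indicator F \<omega>"
      using True assms(4) by simp
    finally show ?thesis .
  next
    case False
    have "(\<Sum>k = 2..n. ?T k \<omega>) \<le> c * normalized_sum \<omega>"
      unfolding normalized_sum_def sum_distrib_left
      by (rule sum_mono) (rule truncated_error_le_powr[OF assms(1)], use assms(3) in simp)
    also have "\<dots> \<le> c * (e / c)"
      using False that assms(2) unfolding F_def by (intro mult_left_mono) auto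
    also have "\<dots> = e + K\<^sup>2 * indicator F \<omega>"
      using False assms(2) by simp
    finally show ?thesis .
  qed
  have "expectation (\<lambda>\<omega>. \<Sum>k = 2..n. ?T k \<omega>) \<le> expectation (\<lambda>\<omega>. e + K\<^sup>2 * indicator F \<omega>)"
  proof (rule integral_mono)
    show "integrable M (\<lambda>\<omega>. \<Sum>k = 2..n. ?T k \<omega>)"
      by (rule Bochner_Integration.integrable_sum[OF int])
    show "integrable M (\<lambda>\<omega>. e + K\<^sup>2 * indicator F \<omega>)"
      by (intro Bochner_Integration.integrable_add integrable_mult_right integrable_real_indicator F)
        (simp_all add: emeasure_eq_measure)
  qed (rule bound)
  also have "\<dots> = e + K\<^sup>2 * prob F"
    using F by (subst Bochner_Integration.integral_add)
      (auto simp: prob_space Int_absorb2 sets.sets_into_space emeasure_eq_measure intro!: integrable_real_indicator)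
  finally have le: "real (n - 1) * (?a / real n) \<le> e + K\<^sup>2 * prob F"
    unfolding mean .
  have "0 \<le> ?a"
    by (intro set_average_nonneg truncated_error_nonneg)
  \<comment> \<open>There are only \<open>n - 1\<close> partners of vertex 1;
    \<open>n <= 2 * (n - 1)\<close> for \<open>n >= 2\<close> gives the factor 2 of the
    statement.\<close>
  then have "real n * ?a \<le> (2 * real (n - 1)) * ?a"
    using assms(3) by (intro mult_right_mono) auto
  then have "?a \<le> (2 * real (n - 1)) * ?a / real n"
    using n(1) by (simp only: pos_le_divide_eq mult.commute)
  also have "\<dots> = 2 * (real (n - 1) * (?a / real n))"
    by (simp only: mult.assoc times_divide_eq_right)
  also have "\<dots> \<le> 2 * (e + K\<^sup>2 * prob F)"
    by (rule mult_left_mono[OF le]) simp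
  finally show ?thesis unfolding F_def .
qed

text \<open>The assumption \<open>K^2 * fact S <= n\<close> makes the base of the power at most 1,
  so lowering the exponent from \<open>1 / s\<close> to \<open>1 / S\<close> enlarges the power. The
  resulting bound no longer involves \<open>s\<close> and tends to 0 as \<open>n\<close> grows when
  \<open>S > 0\<close>.\<close>

lemma size_product_bound_bounded:
  assumes "real m \<le> 2 * real (m - s)" "s \<le> S" "K\<^sup>2 * fact S \<le> real n" "0 \<le> u" "u \<le> K\<^sup>2" "0 < n"
  shows "size_product_bound n m s u \<le> 2 * (K\<^sup>2 * fact S / real n) powr (1 / real S)"
proof -
  let ?x = "u * fact s / real n" and ?y = "K\<^sup>2 * fact S / real n"
  have "u * fact s \<le> K\<^sup>2 * fact S"
    using fact_mono[OF assms(2), where 'a = real] assms(5) by (intro mult_mono) simp_all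
  then have xy: "?x \<le> ?y" by (rule divide_right_mono) simp
  have x: "0 \<le> ?x" using assms(4) by (intro divide_nonneg_nonneg mult_nonneg_nonneg) simp_all
  have y: "?y \<le> 1" using assms(3,6) by (simp only: divide_le_eq_1 of_nat_0_less_iff simp_thms)
  have exponent: "1 / real S \<le> 1 / real s"
    using assms(2) s_bounds(1) by (intro divide_left_mono) auto
  have "?x powr (1 / real s) \<le> ?y powr (1 / real s)"
    by (rule powr_mono2[OF _ x xy]) simp
  also have "\<dots> \<le> ?y powr (1 / real S)"
    by (rule powr_mono'[OF exponent order_trans[OF x xy] y])
  finally have powr: "?x powr (1 / real s) \<le> ?y powr (1 / real S)" .
  have ratio: "real m / real (m - s) \<le> 2"
  proof (cases "m - s = 0")
    case False
    then show ?thesis using assms(1) by (subst pos_divide_le_eq) simp_all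
  qed simp
  show ?thesis
    unfolding size_product_bound_def by (rule mult_mono[OF ratio powr]) simp_all
qed

lemma truncated_error_le_bounded:
  assumes "real m \<le> 2 * real (m - s)" "s \<le> S" "K\<^sup>2 * fact S \<le> real n" "0 < n"
  shows "truncated_error K A B \<le> K\<^sup>2 * (2 * (K\<^sup>2 * fact S / real n) powr (1 / real S))"
proof (cases rule: truncated_error_cases[of A K B])
  case 1
  have u: "0 \<le> z A * z B" by (intro mult_nonneg_nonneg scaled_size_nonneg)
  have uK: "z A * z B \<le> K\<^sup>2" by (rule size_product_le_square[OF 1(1,2)])
  have "truncated_error K A B \<le> z A * z B * size_product_bound n m s (z A * z B)"
    unfolding 1(3) by (rule mult_left_mono[OF min.cobounded2 u])
  also have "\<dots> \<le> K\<^sup>2 * (2 * (K\<^sup>2 * fact S / real n) powr (1 / real S))"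
    by (rule mult_mono[OF uK size_product_bound_bounded[OF assms(1,2,3) u uK assms(4)]])
      (simp_all add: size_product_bound_def)
  finally show ?thesis .
next
  case 2
  show ?thesis unfolding 2 by (intro mult_nonneg_nonneg) simp_all
qed

end

section \<open>Sequences of graphs\<close>

text \<open>What both parts of the theorem share; each part then has to supply \<open>s < m\<close>
  eventually and vanishing truncated errors. Index 0 is left out of \<open>graph\<close> because
  \<open>1 <= s <= m\<close> is impossible there, so the facts below about single graphs hold only
  eventually.\<close>

locale rig_sequence =
  fixes M :: "nat \<Rightarrow> 'a measure"
    and n s :: "nat \<Rightarrow> nat"
    and P :: "nat \<Rightarrow> nat pmf"
    and D :: "nat \<Rightarrow> nat \<Rightarrow> 'a \<Rightarrow> nat set"
    and N :: "'b measure"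
    and Z :: "'b \<Rightarrow> real"
    and \<mu> :: real
  assumes graph: "\<And>m. 1 \<le> m \<Longrightarrow>
      active_random_intersection_graph (M m) (n m) m (s m) (P m) (D m)"
    and n_infinity: "filterlim n at_top sequentially"
    and N: "prob_space N"
    and Z_meas: "Z \<in> borel_measurable N"
    and conv: "weak_conv_m (\<lambda>m. distr (M m) borel (\<lambda>\<omega>. scaled_size (n m) m (s m) (D m 1 \<omega>)))
      (distr N borel Z)"
    and Z_int: "integrable N Z"
    and mean: "(\<lambda>m. \<integral>\<omega>. scaled_size (n m) m (s m) (D m 1 \<omega>) \<partial>M m) \<longlonglongrightarrow> integral\<^sup>L N Z"
    and \<mu>_def: "\<mu> = integral\<^sup>L N Z"
begin

abbreviation "Zm m \<omega> \<equiv> scaled_size (n m) m (s m) (D m 1 \<omega>)"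
abbreviation "avg m \<equiv> active_random_intersection_graph.set_average m (P m)"
abbreviation "deficit m \<equiv> active_random_intersection_graph.edge_deficit (n m) m (s m) (P m)"
abbreviation "error m \<equiv> active_random_intersection_graph.truncated_error (n m) m (s m)"
abbreviation "vertex_degree m \<omega> \<equiv> rig_degree (n m) (s m) (\<lambda>i. D m i \<omega>) 1"
abbreviation "poisson_mixture k \<equiv> 1 / fact k * (\<integral>z. (Z z * \<mu>) ^ k * exp (- (Z z * \<mu>)) \<partial>N)"

lemma eventually_large: "\<forall>\<^sub>F m in sequentially. 1 \<le> m \<and> 2 \<le> n m"
proof -
  have "\<forall>\<^sub>F m in sequentially. 2 \<le> n m"
    using n_infinity by (simp add: filterlim_at_top)
  then show ?thesis
    using eventually_ge_at_top[of 1] by eventually_elim simp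
qed

lemma expectation_Zm:
  fixes f :: "real \<Rightarrow> real"
  assumes "1 \<le> m" "2 \<le> n m"
  shows "(\<integral>\<omega>. f (Zm m \<omega>) \<partial>M m) = avg m (\<lambda>A. f (scaled_size (n m) m (s m) A))"
    and "integrable (M m) (\<lambda>\<omega>. f (Zm m \<omega>))"
proof -
  interpret active_random_intersection_graph "M m" "n m" m "s m" "P m" "D m"
    by (rule graph[OF assms(1)])
  have "1 \<in> {1..n m}" using assms by simp
  from expectation_D[OF this, of "\<lambda>A. f (scaled_size (n m) m (s m) A)"]
  show "(\<integral>\<omega>. f (Zm m \<omega>) \<partial>M m) = avg m (\<lambda>A. f (scaled_size (n m) m (s m) A))"
    and "integrable (M m) (\<lambda>\<omega>. f (Zm m \<omega>))"
    by simp_all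
qed

lemma eventually_prob_space: "\<forall>\<^sub>F m in sequentially. prob_space (M m) \<and> integrable (M m) (Zm m)"
  using eventually_large
proof eventually_elim
  fix m assume m: "1 \<le> m \<and> 2 \<le> n m"
  interpret active_random_intersection_graph "M m" "n m" m "s m" "P m" "D m"
    by (rule graph) (use m in simp)
  show "prob_space (M m) \<and> integrable (M m) (Zm m)"
    using expectation_Zm(2)[of m "\<lambda>x. x"] m prob_space_axioms by simp
qed

lemma eventually_measurable:
  "\<forall>\<^sub>F m in sequentially. prob_space (M m) \<and> Zm m \<in> borel_measurable (M m)"
  using eventually_prob_space by eventually_elim (auto intro: borel_measurable_integrable)

lemma Z_nonneg: "AE \<omega> in N. 0 \<le> Z \<omega>"
  by (rule weak_limit_nonneg[OF eventually_measurable N Z_meas conv]) (rule scaled_size_nonneg)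

lemma \<mu>_nonneg: "0 \<le> \<mu>"
  unfolding \<mu>_def by (rule integral_nonneg_AE[OF Z_nonneg])

lemma avg_size_tendsto: "(\<lambda>m. avg m (scaled_size (n m) m (s m))) \<longlonglongrightarrow> \<mu>"
proof -
  have "\<forall>\<^sub>F m in sequentially. integral\<^sup>L (M m) (Zm m) = avg m (scaled_size (n m) m (s m))"
    using eventually_large by eventually_elim (use expectation_Zm(1)[of _ "\<lambda>x. x"] in simp)
  with mean show ?thesis unfolding \<mu>_def by (rule Lim_transform_eventually)
qed

lemma avg_poisson_tendsto:
  "(\<lambda>m. avg m (\<lambda>A. poisson_weight k (scaled_size (n m) m (s m) A * \<mu>))) \<longlonglongrightarrow> poisson_mixture k"
proof -
  \<comment> \<open>The Poisson weight is unbounded on the negative axis; \<open>max 0\<close> makes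
    the test function bounded and continuous on the whole line, changing nothing for the scaled
    sizes and only a null set for \<open>Z\<close>.\<close>
  let ?f = "\<lambda>x. poisson_weight k (max 0 x * \<mu>)"
  have "continuous_on UNIV ?f"
    unfolding poisson_weight_def by (intro continuous_intros) simp
  moreover have "\<bar>?f x\<bar> \<le> 1" for x
    by (rule poisson_weight_abs) (simp add: \<mu>_nonneg)
  ultimately have "(\<lambda>m. \<integral>\<omega>. ?f (Zm m \<omega>) \<partial>M m) \<longlonglongrightarrow> (\<integral>\<omega>. ?f (Z \<omega>) \<partial>N)"
    by (rule weak_conv_integral_bounded[OF eventually_measurable N Z_meas conv])
  moreover have "\<forall>\<^sub>F m in sequentially. (\<integral>\<omega>. ?f (Zm m \<omega>) \<partial>M m)
      = avg m (\<lambda>A. poisson_weight k (scaled_size (n m) m (s m) A * \<mu>))"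
    using eventually_large
  proof eventually_elim
    fix m assume m: "1 \<le> m \<and> 2 \<le> n m"
    show "(\<integral>\<omega>. ?f (Zm m \<omega>) \<partial>M m) = avg m (\<lambda>A. poisson_weight k (scaled_size (n m) m (s m) A * \<mu>))"
      using expectation_Zm(1)[of m "\<lambda>x. poisson_weight k (x * \<mu>)"] m
      by (simp only: max_absorb2[OF scaled_size_nonneg])
  qed
  ultimately have "(\<lambda>m. avg m (\<lambda>A. poisson_weight k (scaled_size (n m) m (s m) A * \<mu>)))
      \<longlonglongrightarrow> (\<integral>\<omega>. ?f (Z \<omega>) \<partial>N)"
    by (rule Lim_transform_eventually)
  also have "(\<integral>\<omega>. ?f (Z \<omega>) \<partial>N) = (\<integral>\<omega>. 1 / fact k * ((Z \<omega> * \<mu>) ^ k * exp (- (Z \<omega> * \<mu>))) \<partial>N)"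
  proof (rule integral_cong_AE)
    show "AE \<omega> in N. ?f (Z \<omega>) = 1 / fact k * ((Z \<omega> * \<mu>) ^ k * exp (- (Z \<omega> * \<mu>)))"
      using Z_nonneg by eventually_elim (simp add: poisson_weight_def)
  qed (use Z_meas in \<open>simp_all add: poisson_weight_def\<close>)
  also have "\<dots> = poisson_mixture k"
    by (rule integral_mult_right_zero)
  finally show ?thesis .
qed

lemma degree_tendsto_of_deficit:
  assumes "(\<lambda>m. avg m (deficit m)) \<longlonglongrightarrow> 0"
  shows "(\<lambda>m. measure (M m) {\<omega> \<in> space (M m). vertex_degree m \<omega> = k}) \<longlonglongrightarrow> poisson_mixture k"
proof -
  let ?e = "\<lambda>m. avg m (scaled_size (n m) m (s m))"
  let ?a = "\<lambda>m. avg m (\<lambda>A. poisson_weight k (scaled_size (n m) m (s m) A * \<mu>))"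
  let ?p = "\<lambda>m. measure (M m) {\<omega> \<in> space (M m). vertex_degree m \<omega> = k}"
  let ?b = "\<lambda>m. (sqrt (2 * real (n m)) + 1) / real (n m) * (?e m)\<^sup>2 + avg m (deficit m)
      + ?e m * \<bar>?e m - \<mu>\<bar>"
  have "((\<lambda>x::real. (sqrt (2 * x) + 1) / x) \<longlongrightarrow> 0) at_top"
    by real_asymp
  then have "(\<lambda>m. (sqrt (2 * real (n m)) + 1) / real (n m)) \<longlonglongrightarrow> 0"
    by (rule filterlim_compose) (rule filterlim_compose[OF filterlim_real_sequentially n_infinity])
  from tendsto_add[OF tendsto_add[OF tendsto_mult[OF this tendsto_power[OF avg_size_tendsto, of 2]] assms]
      tendsto_mult[OF avg_size_tendsto tendsto_rabs[OF tendsto_diff[OF avg_size_tendsto tendsto_const[of \<mu>]]]]]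
  have "?b \<longlonglongrightarrow> 0" by simp
  moreover have "\<forall>\<^sub>F m in sequentially. norm (?p m - ?a m) \<le> ?b m"
    using eventually_large
  proof eventually_elim
    fix m assume m: "1 \<le> m \<and> 2 \<le> n m"
    interpret active_random_intersection_graph "M m" "n m" m "s m" "P m" "D m"
      by (rule graph) (use m in simp)
    show "norm (?p m - ?a m) \<le> ?b m"
      unfolding real_norm_def by (rule degree_approx) (use m \<mu>_nonneg in simp_all)
  qed
  ultimately have "(\<lambda>m. ?p m - ?a m) \<longlonglongrightarrow> 0"
    by (rule Lim_null_comparison[rotated])
  from tendsto_add[OF this avg_poisson_tendsto[of k]] show ?thesis by simp
qed

lemma deficit_tendsto_0:
  assumes s: "\<forall>\<^sub>F m in sequentially. s m < m"
    and error: "\<And>K. 0 < K \<Longrightarrow> (\<lambda>m. avg m (\<lambda>A. avg m (error m K A))) \<longlonglongrightarrow> 0"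
  shows "(\<lambda>m. avg m (deficit m)) \<longlonglongrightarrow> 0"
proof (rule tendstoI)
  fix e :: real assume e: "0 < e"
  let ?e = "\<lambda>m. avg m (scaled_size (n m) m (s m))"
  \<comment> \<open>An eventual upper bound for twice the mean of \<open>z\<close>, the coefficient
    of the tail. The level \<open>K\<close> is chosen from the tail bound after \<open>e\<close>,
    which is why \<open>error\<close> is assumed for every positive \<open>K\<close>.\<close>
  let ?c = "2 * (\<mu> + 1)"
  have c: "0 < ?c" using \<mu>_nonneg by simp
  obtain K where K: "0 < K" and tail:
    "\<forall>\<^sub>F m in sequentially. (\<integral>\<omega>. Zm m \<omega> * of_bool (K < Zm m \<omega>) \<partial>M m) < e / 2 / ?c"
    using weak_conv_mean_tail[OF eventually_prob_space N Z_int conv scaled_size_nonneg mean, of "e / 2 / ?c"] e c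
    by (auto simp only: divide_pos_pos zero_less_numeral)
  have "\<forall>\<^sub>F m in sequentially. ?e m < \<mu> + 1"
    by (rule order_tendstoD[OF avg_size_tendsto]) simp
  moreover have "\<forall>\<^sub>F m in sequentially. avg m (\<lambda>A. avg m (error m K A)) < e / 2"
    by (rule order_tendstoD[OF error[OF K]]) (use e in simp)
  ultimately show "\<forall>\<^sub>F m in sequentially. dist (avg m (deficit m)) 0 < e"
    using tail s eventually_large
  proof eventually_elim
    fix m
    assume e1: "?e m < \<mu> + 1" and err: "avg m (\<lambda>A. avg m (error m K A)) < e / 2"
      and tl: "(\<integral>\<omega>. Zm m \<omega> * of_bool (K < Zm m \<omega>) \<partial>M m) < e / 2 / ?c"
      and sm: "s m < m" and m: "1 \<le> m \<and> 2 \<le> n m"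
    interpret active_random_intersection_graph "M m" "n m" m "s m" "P m" "D m"
      by (rule graph) (use m in simp)
    have tail_eq: "(\<integral>\<omega>. Zm m \<omega> * of_bool (K < Zm m \<omega>) \<partial>M m) = size_tail K"
      unfolding size_tail_def by (rule expectation_Zm) (use m in simp_all)
    have tail0: "0 \<le> size_tail K"
      unfolding size_tail_def by (intro set_average_nonneg mult_nonneg_nonneg scaled_size_nonneg) simp
    have "set_average edge_deficit \<le> 2 * ?e m * size_tail K + avg m (\<lambda>A. avg m (error m K A))"
      by (rule set_average_edge_deficit_le) (use sm m in simp_all)
    also have "2 * ?e m * size_tail K \<le> ?c * size_tail K"
      using e1 tail0 by (intro mult_right_mono) simp_all
    also have "?c * size_tail K \<le> ?c * (e / 2 / ?c)"
      using tl c unfolding tail_eq by (intro mult_left_mono) simp_all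
    also have "?c * (e / 2 / ?c) = e / 2"
      using c by (subst times_divide_eq_right, subst nonzero_mult_div_cancel_left) simp_all
    finally have "set_average edge_deficit \<le> e / 2 + avg m (\<lambda>A. avg m (error m K A))" by simp
    then have "set_average edge_deficit < e" using err by linarith
    moreover have "0 \<le> set_average edge_deficit"
      by (intro set_average_nonneg edge_deficit_nonneg)
    ultimately show "dist (avg m (deficit m)) 0 < e" by simp
  qed
qed

section \<open>The two regimes of \<open>s\<close>\<close>

lemma degree_tendsto_bounded:
  assumes "(\<lambda>m. real (s m)) \<in> O(\<lambda>m. 1)"
  shows "(\<lambda>m. measure (M m) {\<omega> \<in> space (M m). vertex_degree m \<omega> = k}) \<longlonglongrightarrow> poisson_mixture k"
proof (intro degree_tendsto_of_deficit deficit_tendsto_0)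
  obtain c where "\<forall>\<^sub>F m in sequentially. norm (real (s m)) \<le> c * norm (1::real)"
    using landau_o.bigE[OF assms] by blast
  moreover obtain S where "c \<le> real S" using real_arch_simple by blast
  ultimately have "\<forall>\<^sub>F m in sequentially. s m \<le> S"
    by (auto elim!: eventually_mono)
  \<comment> \<open>The bound \<open>2 * S + 1 <= m\<close> yields both \<open>s < m\<close> and
    \<open>m <= 2 * (m - s)\<close>.\<close>
  then have large: "\<forall>\<^sub>F m in sequentially. s m \<le> S \<and> 2 * S + 1 \<le> m \<and> 1 \<le> m \<and> 2 \<le> n m"
    using eventually_ge_at_top[of "2 * S + 1"] eventually_large by eventually_elim simp
  then show "\<forall>\<^sub>F m in sequentially. s m < m"
    by eventually_elim simp
  fix K :: real assume K: "0 < K"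
  let ?b = "\<lambda>m. K\<^sup>2 * (2 * (K\<^sup>2 * fact S / real (n m)) powr (1 / real S))"
  have n_real: "filterlim (\<lambda>m. real (n m)) at_top sequentially"
    by (rule filterlim_compose[OF filterlim_real_sequentially n_infinity])
  \<comment> \<open>The exponent \<open>1 / S\<close> must be positive for the power to tend to 0;
    positivity is read off from one graph of the sequence, where \<open>1 <= s <= S\<close>.\<close>
  have S: "0 < S"
  proof -
    obtain m where m: "s m \<le> S \<and> 2 * S + 1 \<le> m \<and> 1 \<le> m \<and> 2 \<le> n m"
      using eventually_happens'[OF sequentially_bot large] by blast
    interpret active_random_intersection_graph "M m" "n m" m "s m" "P m" "D m"
      by (rule graph) (use m in simp)
    show ?thesis using m s_bounds by simp
  qed
  have "(\<lambda>m. K\<^sup>2 * fact S / real (n m)) \<longlonglongrightarrow> 0"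
    by (rule tendsto_divide_0[OF tendsto_const filterlim_at_top_imp_at_infinity[OF n_real]])
  then have "(\<lambda>m. (K\<^sup>2 * fact S / real (n m)) powr (1 / real S)) \<longlonglongrightarrow> 0"
    by (rule tendsto_zero_powrI[OF _ tendsto_const]) (use S in simp_all)
  from tendsto_mult_left[OF tendsto_mult_left[OF this, of 2], of "K\<^sup>2"] have "?b \<longlonglongrightarrow> 0" by simp
  moreover have "\<forall>\<^sub>F m in sequentially. norm (avg m (\<lambda>A. avg m (error m K A))) \<le> ?b m"
  proof -
    have "\<forall>\<^sub>F m in sequentially. K\<^sup>2 * fact S \<le> real (n m)"
      using n_real by (simp add: filterlim_at_top)
    then show ?thesis
      using large
    proof eventually_elim
      fix m assume n: "K\<^sup>2 * fact S \<le> real (n m)"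
        and m: "s m \<le> S \<and> 2 * S + 1 \<le> m \<and> 1 \<le> m \<and> 2 \<le> n m"
      interpret active_random_intersection_graph "M m" "n m" m "s m" "P m" "D m"
        by (rule graph) (use m in simp)
      have le: "truncated_error K A B \<le> ?b m" for A B
        by (rule truncated_error_le_bounded) (use m n in \<open>simp_all add: of_nat_diff\<close>)
      have "set_average (\<lambda>A. set_average (truncated_error K A)) \<le> set_average (\<lambda>A. set_average (\<lambda>B. ?b m))"
        by (intro set_average_mono le)
      also have "\<dots> = ?b m" by (simp only: set_average_const)
      finally have "set_average (\<lambda>A. set_average (truncated_error K A)) \<le> ?b m" .
      moreover have "0 \<le> set_average (\<lambda>A. set_average (truncated_error K A))"
        by (intro set_average_nonneg truncated_error_nonneg)
      ultimately show "norm (avg m (\<lambda>A. avg m (error m K A))) \<le> ?b m"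
        unfolding real_norm_def by (simp only: abs_of_nonneg)
    qed
  qed
  ultimately show "(\<lambda>m. avg m (\<lambda>A. avg m (error m K A))) \<longlonglongrightarrow> 0"
    by (rule Lim_null_comparison[rotated])
qed

lemma degree_tendsto_in_probability:
  assumes a: "0 < a" "a < 1" "\<forall>\<^sub>F m in sequentially. real (s m) \<le> a * real m"
    and iii: "tendsto_zero_in_probability M
      (\<lambda>m. active_random_intersection_graph.normalized_sum (n m) m (s m) (D m))"
  shows "(\<lambda>m. measure (M m) {\<omega> \<in> space (M m). vertex_degree m \<omega> = k}) \<longlonglongrightarrow> poisson_mixture k"
proof (intro degree_tendsto_of_deficit deficit_tendsto_0)
  have large: "\<forall>\<^sub>F m in sequentially. real (s m) \<le> a * real m \<and> 1 \<le> m \<and> 2 \<le> n m"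
    using a(3) eventually_large by eventually_elim simp
  have less: "s m < m" if "real (s m) \<le> a * real m" "1 \<le> m" for m
  proof -
    have "a * real m < 1 * real m"
      using a that(2) by (intro mult_strict_right_mono) simp_all
    then show ?thesis using that(1) by simp
  qed
  show "\<forall>\<^sub>F m in sequentially. s m < m"
    using large by eventually_elim (simp add: less)
  fix K :: real assume K: "0 < K"
  \<comment> \<open>The bound \<open>s <= a m\<close> keeps \<open>m - s\<close> at least
    \<open>(1 - a) m\<close>, so this constant bounds the ratio \<open>m / (m - s)\<close>.\<close>
  let ?c = "1 / (1 - a)"
  let ?Y = "\<lambda>m. active_random_intersection_graph.normalized_sum (n m) m (s m) (D m)"
  have c: "0 < ?c" using a by simp
  have ratio: "real m / real (m - s m) \<le> ?c" if "real (s m) \<le> a * real m" "1 \<le> m" for m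
  proof -
    have "(1 - a) * real m \<le> real (m - s m)"
      using that less[OF that] by (simp add: of_nat_diff algebra_simps)
    then have "real m \<le> real (m - s m) / (1 - a)"
      using a(2) by (simp add: pos_le_divide_eq mult.commute)
    then show ?thesis
      using less[OF that] by (simp add: pos_divide_le_eq)
  qed
  show "(\<lambda>m. avg m (\<lambda>A. avg m (error m K A))) \<longlonglongrightarrow> 0"
  proof (rule tendstoI)
    fix e :: real assume e: "0 < e"
    \<comment> \<open>The threshold is set so that the error allowed off the exceptional event is
      \<open>e / 4\<close>; with another \<open>e / 4\<close> for the event itself, the factor 2
      gives \<open>e\<close> in total.\<close>
    let ?q = "\<lambda>m. measure (M m) {\<omega> \<in> space (M m). e / 4 / ?c < \<bar>?Y m \<omega>\<bar>}"
    have "0 < e / 4 / ?c" using e c by (intro divide_pos_pos) simp_all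
    then have "?q \<longlonglongrightarrow> 0"
      using iii unfolding tendsto_zero_in_probability_def by blast
    from tendsto_mult_left[OF this, of "K\<^sup>2"] have "(\<lambda>m. K\<^sup>2 * ?q m) \<longlonglongrightarrow> 0" by simp
    then have "\<forall>\<^sub>F m in sequentially. K\<^sup>2 * ?q m < e / 4"
      by (rule order_tendstoD) (use e in simp)
    then show "\<forall>\<^sub>F m in sequentially. dist (avg m (\<lambda>A. avg m (error m K A))) 0 < e"
      using large
    proof eventually_elim
      fix m assume q: "K\<^sup>2 * ?q m < e / 4"
        and m: "real (s m) \<le> a * real m \<and> 1 \<le> m \<and> 2 \<le> n m"
      interpret active_random_intersection_graph "M m" "n m" m "s m" "P m" "D m"
        by (rule graph) (use m in simp)
      have "set_average (\<lambda>A. set_average (truncated_error K A)) \<le> 2 * (e / 4 + K\<^sup>2 * ?q m)"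
        by (rule set_average_truncated_error_le[OF ratio c]) (use m e in simp_all)
      also have "\<dots> < 2 * (e / 4 + e / 4)"
        using q by (intro mult_strict_left_mono add_strict_left_mono) simp_all
      finally have "set_average (\<lambda>A. set_average (truncated_error K A)) < e" by simp
      moreover have "0 \<le> set_average (\<lambda>A. set_average (truncated_error K A))"
        by (intro set_average_nonneg truncated_error_nonneg)
      ultimately show "dist (avg m (\<lambda>A. avg m (error m K A))) 0 < e" by simp
    qed
  qed
qed

end

theorem theorem2p1:
  fixes M :: "nat \<Rightarrow> 'a measure"
    and n s :: "nat \<Rightarrow> nat"
    and P :: "nat \<Rightarrow> nat pmf"
    and D :: "nat \<Rightarrow> nat \<Rightarrow> 'a \<Rightarrow> nat set"
    and N :: "'b measure"
    and Z :: "'b \<Rightarrow> real"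
    and Zm :: "nat \<Rightarrow> nat \<Rightarrow> 'a \<Rightarrow> real"
    and d :: "nat \<Rightarrow> 'a \<Rightarrow> nat"
    and \<mu> :: real
  assumes graph: "\<And>m. m \<ge> 1 \<Longrightarrow>
      active_random_intersection_graph (M m) (n m) m (s m) (P m) (D m)"
    and n_infinity: "filterlim n at_top sequentially"
    and Zm_def: "\<And>m i \<omega>. Zm m i \<omega> = scaled_size (n m) m (s m) (D m i \<omega>)"
    and d_def: "\<And>m \<omega>. d m \<omega> = rig_degree (n m) (s m) (\<lambda>i. D m i \<omega>) 1"
    and "prob_space N"
    and "Z \<in> borel_measurable N"
    and i: "weak_conv_m (\<lambda>m. distr (M m) borel (Zm m 1)) (distr N borel Z)"
    and ii: "integrable N Z"
            "(\<lambda>m. integral\<^sup>L (M m) (Zm m 1)) \<longlonglongrightarrow> integral\<^sup>L N Z"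
    and \<mu>_def: "\<mu> = integral\<^sup>L N Z"
  shows "((\<lambda>m. real (s m)) \<in> O(\<lambda>m. 1) \<longrightarrow>
      (\<forall>k. (\<lambda>m. measure (M m) {\<omega> \<in> space (M m). d m \<omega> = k})
        \<longlonglongrightarrow> 1 / fact k * (\<integral>z. (Z z * \<mu>) ^ k * exp (- (Z z * \<mu>)) \<partial>N)))
    \<and>
    ((\<exists>a. 0 < a \<and> a < 1 \<and> (\<forall>\<^sub>F m in sequentially. real (s m) \<le> a * real m)) \<and>
      (\<lambda>m. (fact (s m) / real (n m)) powr (1 / real (s m))) \<in> o(\<lambda>m. real m) \<and>
      tendsto_zero_in_probability M
        (\<lambda>m \<omega>. fact (s m) powr (1 / real (s m)) / real (n m) powr ((real (s m) + 1) / real (s m))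
           * (\<Sum>k = 2..n m. (Zm m 1 \<omega> * Zm m k \<omega>) powr ((real (s m) + 1) / real (s m)))) \<longrightarrow>
      (\<forall>k. (\<lambda>m. measure (M m) {\<omega> \<in> space (M m). d m \<omega> = k})
        \<longlonglongrightarrow> 1 / fact k * (\<integral>z. (Z z * \<mu>) ^ k * exp (- (Z z * \<mu>)) \<partial>N)))"
proof -
  have Zm_eq: "Zm m i = (\<lambda>\<omega>. scaled_size (n m) m (s m) (D m i \<omega>))" for m i
    by (rule ext) (rule Zm_def)
  interpret rig_sequence M n s P D N Z \<mu>
    by (rule rig_sequence.intro)
      (fact graph n_infinity assms(5,6) i[unfolded Zm_eq] ii[unfolded Zm_eq] \<mu>_def)+
  have "(\<lambda>m. measure (M m) {\<omega> \<in> space (M m). d m \<omega> = k}) \<longlonglongrightarrow> poisson_mixture k"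
    if "(\<lambda>m. real (s m)) \<in> O(\<lambda>m. 1)" for k
    using degree_tendsto_bounded[OF that] unfolding d_def .
  moreover have "(\<lambda>m. measure (M m) {\<omega> \<in> space (M m). d m \<omega> = k}) \<longlonglongrightarrow> poisson_mixture k"
    if a: "0 < a" "a < 1" "\<forall>\<^sub>F m in sequentially. real (s m) \<le> a * real m"
      and iii: "tendsto_zero_in_probability M
        (\<lambda>m \<omega>. fact (s m) powr (1 / real (s m)) / real (n m) powr ((real (s m) + 1) / real (s m))
           * (\<Sum>k = 2..n m. (Zm m 1 \<omega> * Zm m k \<omega>) powr ((real (s m) + 1) / real (s m))))"
    for a k
  proof -
    have "tendsto_zero_in_probability M
        (\<lambda>m. active_random_intersection_graph.normalized_sum (n m) m (s m) (D m))"
      unfolding tendsto_zero_in_probability_def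
    proof (intro allI impI)
      fix e :: real assume "0 < e"
      with iii have "(\<lambda>m. measure (M m) {\<omega> \<in> space (M m). e < \<bar>fact (s m) powr (1 / real (s m))
          / real (n m) powr ((real (s m) + 1) / real (s m))
          * (\<Sum>k = 2..n m. (Zm m 1 \<omega> * Zm m k \<omega>) powr ((real (s m) + 1) / real (s m)))\<bar>}) \<longlonglongrightarrow> 0"
        unfolding tendsto_zero_in_probability_def by blast
      \<comment> \<open>The locale constant \<open>normalized_sum\<close> unfolds only where the
        graph assumptions hold, so the two expressions are identified from index 1 on.\<close>
      moreover have "\<forall>\<^sub>F m in sequentially. measure (M m) {\<omega> \<in> space (M m).
          e < \<bar>fact (s m) powr (1 / real (s m)) / real (n m) powr ((real (s m) + 1) / real (s m))
          * (\<Sum>k = 2..n m. (Zm m 1 \<omega> * Zm m k \<omega>) powr ((real (s m) + 1) / real (s m)))\<bar>}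
        = measure (M m) {\<omega> \<in> space (M m).
          e < \<bar>active_random_intersection_graph.normalized_sum (n m) m (s m) (D m) \<omega>\<bar>}"
        using eventually_ge_at_top[of 1]
        by eventually_elim
          (simp only: active_random_intersection_graph.normalized_sum_def[OF graph] Zm_def)
      ultimately show "(\<lambda>m. measure (M m) {\<omega> \<in> space (M m).
          e < \<bar>active_random_intersection_graph.normalized_sum (n m) m (s m) (D m) \<omega>\<bar>}) \<longlonglongrightarrow> 0"
        by (rule Lim_transform_eventually)
    qed
    from degree_tendsto_in_probability[OF a this] show ?thesis unfolding d_def .
  qed
  ultimately show ?thesis by blast
qed

end
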